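(* Let $k=k(n)\ge1$ be any sequence of integers with $k\le n$ and $k=o(\sqrt n)$ as $n\to\infty$. Then, as $n\to\infty$: (i) the variance of $Y_{n,k}$ satisfies $$\mathrm{Var}(Y_{n,k})=\frac{k^2-1}{12}\,n+O(k^3\sqrt n);$$ (ii) if moreover $k\ge2$, the distribution of $Y_{n,k}$ is asymptotically Gaussian, i.e. $\bigl(Y_{n,k}-\mathrm{E}(Y_{n,k})\bigr)/\sqrt{\mathrm{Var}(Y_{n,k})}$ converges in distribution to the standard normal distribution $\mathcal N(0,1)$.
   Context: $[n]=\{1,\dots,n\}$ and $\Pi_n^k$ is the set of all partitions of $[n]$ into $k$ (nonempty) blocks. For a set partition $\pi$ of $[n]$, the chords of its circular representation are obtained by placing $1,\dots,n$ in order on a circle and drawing each block as the convex polygon on its elements: a block $\{b_1<\dots<b_m\}$ contributes no chord if $m=1$, the single chord $\{b_1,b_2\}$ if $m=2$, and the $m$ chords $\{b_1,b_2\},\dots,\{b_{m-1},b_m\},\{b_1,b_m\}$ if $m\ge3$. $\mathrm{cr}^{(c)}(\pi)$ is the number of (unordered) pairs of crossing chords, i.e. pairs of chords $\{i,j\},\{i',j'\}$ with $i<i'<j<j'$. $Y_{n,k}$ is the random variable equal to $\mathrm{cr}^{(c)}(\pi)$ for $\pi$ uniformly distributed on $\Pi_n^k$. *)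

theory Defs
  imports "HOL-Probability.Probability" "HOL-Library.Landau_Symbols"
begin

definition set_partitions :: "nat \<Rightarrow> nat \<Rightarrow> nat set set set" where
  "set_partitions n k = {\<pi>. partition_on {1..n} \<pi> \<and> card \<pi> = k}"

lemma finite_set_partitions: "finite (set_partitions n k)"
  by (rule finite_subset[of _ "Pow (Pow {1..n})"])
     (auto simp: set_partitions_def partition_on_def)

(* Since pmf_of_set is only meaningful on finite nonempty sets, we record nonemptiness. *)
lemma set_partitions_nonempty:
  assumes "1 \<le> k" "k \<le> n"
  shows "set_partitions n k \<noteq> {}"
proof -
  define \<pi> where "\<pi> = insert {k..n} ((\<lambda>i. {i}) ` {1..<k})"
  have "partition_on {1..n} \<pi>"
    using assms by (auto simp: partition_on_def \<pi>_def disjoint_def)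
  moreover have "{k..n} \<notin> (\<lambda>i. {i}) ` {1..<k}"
  proof
    assume "{k..n} \<in> (\<lambda>i. {i}) ` {1..<k}"
    then obtain i where "{k..n} = {i}" "i < k" by auto
    moreover have "k \<in> {k..n}" using assms by simp
    ultimately show False by simp
  qed
  then have "card \<pi> = k"
    using assms by (simp add: \<pi>_def card_image)
  ultimately show ?thesis
    by (auto simp: set_partitions_def)
qed

(* The chord {i,j} with i < j is encoded as the ordered pair (i,j). *)
definition block_chords :: "nat set \<Rightarrow> (nat \<times> nat) set" where
  "block_chords B =
     (let b = sorted_list_of_set B; m = length b in
        {(b ! i, b ! Suc i) | i. Suc i < m} \<union>
        (if 3 \<le> m then {(b ! 0, b ! (m - 1))} else {}))"

definition circular_chords :: "nat set set \<Rightarrow> (nat \<times> nat) set" where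
  "circular_chords \<pi> = (\<Union>B\<in>\<pi>. block_chords B)"

(* The condition i < i' < j < j' orders the two chords of a crossing, so every unordered
   pair of crossing chords is counted exactly once. *)
definition circular_crossings :: "nat set set \<Rightarrow> nat" where
  "circular_crossings \<pi> =
     card {((i, j), (i', j')) | i j i' j'.
             (i, j) \<in> circular_chords \<pi> \<and> (i', j') \<in> circular_chords \<pi> \<and>
             i < i' \<and> i' < j \<and> j < j'}"

(* The random variable Y_{n,k} is crossings_rv on the probability space partition_pmf n k. *)
definition partition_pmf :: "nat \<Rightarrow> nat \<Rightarrow> nat set set pmf" where
  "partition_pmf n k = pmf_of_set (set_partitions n k)"

definition crossings_rv :: "nat set set \<Rightarrow> real" where
  "crossings_rv \<pi> = real (circular_crossings \<pi>)"

definition crossings_mean :: "nat \<Rightarrow> nat \<Rightarrow> real" where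
  "crossings_mean n k = measure_pmf.expectation (partition_pmf n k) crossings_rv"

definition crossings_variance :: "nat \<Rightarrow> nat \<Rightarrow> real" where
  "crossings_variance n k = measure_pmf.variance (partition_pmf n k) crossings_rv"

end

theory Submission
  imports Defs "HOL-Real_Asymp.Real_Asymp"
begin

text \<open>
  Naming the blocks of a partition of \<open>{1..n}\<close> into \<open>k\<close> blocks by the letters \<open>0, \<dots>, k - 1\<close> turns it
  into a surjective word \<open>c\<close> of length \<open>n\<close>, and every partition comes from exactly \<open>k!\<close> words. A
  uniform random word fails to be surjective with probability at most \<open>k * exp (- n / k)\<close>, which is
  negligible for \<open>k = o(sqrt n)\<close>. So the number of crossings may be studied for words with
  independent uniform letters.

  The key is to read the word from left to right while keeping the letters in a move-to-front list,
  that is, sorted by the time of their last occurrence, most recent first. The number of letters in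
  front of the letter that is read next is its rank. Whatever the current list is, a uniform random
  letter has a uniform random rank in \<open>{0..<k}\<close>, so the sum of all ranks, the move-to-front cost
  \<open>mtf_cost\<close>, is distributed exactly as a sum of \<open>n\<close> independent uniform variables on \<open>{0..<k}\<close>
  (\<open>sum_mtf_cost_Suc\<close>). Its variance is \<open>n * (k^2 - 1) / 12\<close>.

  The cost is almost the number of crossings. Suppose that the letter \<open>c j\<close> last occurred at \<open>i'\<close>, and
  that the letter \<open>a\<close> in front of it last occurred at \<open>i\<close>, so \<open>i' < i < j\<close>. Then the chord from \<open>i'\<close>
  to \<open>j\<close> is crossed by the chord from \<open>i\<close> to the next occurrence of \<open>a\<close>, and every crossing of chords
  between consecutive elements of blocks arises from exactly one such pair \<open>(j, a)\<close>. The exceptions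
  are the pairs where \<open>j\<close> is a first occurrence or \<open>i\<close> is a last one, which are at most \<open>2 * k^2\<close> because
  such a pair is determined by its two letters, and the crossings with one of the \<open>k\<close> chords that close
  the polygons, which are at most \<open>3 * k^2\<close> because for every letter at most one chord between
  consecutive occurrences passes over a given point. The first exceptions
  only increase the cost and the second ones only the number of crossings. Hence the two differ by at
  most \<open>3 * k^2\<close> for every word (\<open>crossings_mtf_cost\<close>).

  A perturbation by \<open>O(k^2)\<close> of a variable whose standard deviation is of order \<open>k * sqrt n\<close> changes the
  variance by \<open>O(k^3 * sqrt n)\<close>, which is the error term of the first claim. For the second claim, the
  perturbation of the normalised variable is \<open>O(k / sqrt n)\<close>, so its characteristic function is close
  to the \<open>n\<close>-th power of that of a uniform variable on \<open>{0..<k}\<close>. Since \<open>k\<close> varies with \<open>n\<close>, this is a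
  triangular array; a third-order Taylor estimate that is uniform in \<open>k \<ge> 2\<close> gives the Gaussian limit
  (\<open>uniform_sum_char_approx\<close>), and Levy's continuity theorem concludes.
\<close>

section \<open>The move-to-front cost of a word\<close>

text \<open>
  The value \<open>- a\<close> for a letter that has not occurred before \<open>j\<close> puts the unread letters behind all
  others, in the order \<open>0, 1, 2, \<dots>\<close>. So the letters sorted by decreasing \<open>last_time\<close> are the state of
  a move-to-front list that starts as \<open>0, 1, 2, \<dots>\<close>.
\<close>

definition last_time :: "(nat \<Rightarrow> nat) \<Rightarrow> nat \<Rightarrow> nat \<Rightarrow> int" where
  "last_time c j a =
     (if \<exists>m\<in>{1..<j}. c m = a then int (Max {m\<in>{1..<j}. c m = a}) else - int a)"

definition mtf_rank :: "nat \<Rightarrow> (nat \<Rightarrow> nat) \<Rightarrow> nat \<Rightarrow> nat" where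
  "mtf_rank k c j = card {a\<in>{..<k}. last_time c j (c j) < last_time c j a}"

definition mtf_cost :: "nat \<Rightarrow> nat \<Rightarrow> (nat \<Rightarrow> nat) \<Rightarrow> nat" where
  "mtf_cost k n c = (\<Sum>j\<in>{1..n}. mtf_rank k c j)"

definition words :: "nat \<Rightarrow> nat \<Rightarrow> (nat \<Rightarrow> nat) set" where
  "words n k = ({1..n} \<rightarrow>\<^sub>E {..<k})"

lemma finite_words: "finite (words n k)"
  by (simp add: words_def finite_PiE)

lemma card_words: "card (words n k) = k ^ n"
  by (simp add: words_def card_PiE)

lemma last_time_cong:
  assumes "\<And>m. 1 \<le> m \<Longrightarrow> m < j \<Longrightarrow> c m = c' m"
  shows "last_time c j a = last_time c' j a"
proof -
  have "(\<exists>m\<in>{1..<j}. c m = a) = (\<exists>m\<in>{1..<j}. c' m = a)"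
    using assms by auto
  moreover have "{m\<in>{1..<j}. c m = a} = {m\<in>{1..<j}. c' m = a}"
    using assms by auto
  ultimately show ?thesis by (simp add: last_time_def)
qed

lemma last_time_eqI:
  assumes "1 \<le> i" "i < j" "c i = a" "\<And>m. i < m \<Longrightarrow> m < j \<Longrightarrow> c m \<noteq> a"
  shows "last_time c j a = int i"
proof -
  have "Max {m\<in>{1..<j}. c m = a} = i"
  proof (rule Max_eqI)
    show "m \<le> i" if "m \<in> {m\<in>{1..<j}. c m = a}" for m
      using assms(4)[of m] that by (cases "i < m") simp_all
  qed (use assms(1-3) in simp_all)
  moreover have "\<exists>m\<in>{1..<j}. c m = a"
    using assms(1-3) by (intro bexI[of _ i]) simp_all
  ultimately show ?thesis
    by (simp add: last_time_def)
qed

lemma last_time_obtain: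
  assumes "m \<in> {1..<j}" "c m = a"
  obtains i where "1 \<le> i" "i < j" "c i = a" "\<And>m. i < m \<Longrightarrow> m < j \<Longrightarrow> c m \<noteq> a"
    "last_time c j a = int i"
proof -
  define i where "i = Max {m\<in>{1..<j}. c m = a}"
  have fin: "finite {m\<in>{1..<j}. c m = a}" by simp
  have "i \<in> {m\<in>{1..<j}. c m = a}"
    unfolding i_def using assms by (intro Max_in) auto
  then have i: "1 \<le> i" "i < j" "c i = a" by simp_all
  have "m \<le> i" if "m \<in> {1..<j}" "c m = a" for m
    unfolding i_def using that by (intro Max_ge) auto
  then have gap: "c m \<noteq> a" if "i < m" "m < j" for m
    using that by (metis atLeastLessThan_iff i(1) less_imp_le not_le order.trans)
  have last: "last_time c j a = int i"
    by (rule last_time_eqI) (fact i gap)+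
  show thesis
    by (rule that[of i]) (fact i gap last)+
qed

lemma last_time_pos_iff: "0 < last_time c j a \<longleftrightarrow> (\<exists>m\<in>{1..<j}. c m = a)"
proof (cases "\<exists>m\<in>{1..<j}. c m = a")
  case True
  then obtain m where m: "m \<in> {1..<j}" "c m = a" by blast
  obtain i where "1 \<le> i" "last_time c j a = int i"
    using last_time_obtain[of m j c a, OF m] by metis
  then show ?thesis using True by simp
next
  case False
  then show ?thesis by (simp add: last_time_def)
qed

lemma inj_last_time: "inj (last_time c j)"
proof (rule injI)
  fix a b assume eq: "last_time c j a = last_time c j b"
  show "a = b"
  proof (cases "0 < last_time c j a")
    case True
    with eq have "0 < last_time c j b" by simp
    with True obtain m m' where m: "m \<in> {1..<j}" "c m = a" "m' \<in> {1..<j}" "c m' = b"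
      unfolding last_time_pos_iff by blast
    obtain i where "c i = a" "last_time c j a = int i"
      using last_time_obtain[of m j c a, OF m(1,2)] by metis
    moreover obtain i' where "c i' = b" "last_time c j b = int i'"
      using last_time_obtain[of m' j c b, OF m(3,4)] by metis
    ultimately show ?thesis using eq by simp
  next
    case False
    with eq have "\<not> 0 < last_time c j b" by simp
    with False have "\<not> (\<exists>m\<in>{1..<j}. c m = a)" "\<not> (\<exists>m\<in>{1..<j}. c m = b)"
      unfolding last_time_pos_iff by blast+
    then show ?thesis using eq by (simp add: last_time_def)
  qed
qed

text \<open>
  In a list without repetitions, the letters and their ranks determine each other. This is what makes
  the rank of a uniform letter uniform, whatever the list.
\<close>

lemma bij_betw_rank:
  fixes l :: "nat \<Rightarrow> 'a::linorder"
  assumes "inj l"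
  shows "bij_betw (\<lambda>b. card {a\<in>{..<k}. l b < l a}) {..<k} {..<k}"
proof -
  let ?r = "\<lambda>b. card {a\<in>{..<k}. l b < l a}"
  have less: "?r b' < ?r b" if "b < k" "b' < k" "l b < l b'" for b b'
    using that by (intro psubset_card_mono psubsetI) auto
  have inj: "inj_on ?r {..<k}"
  proof (rule inj_onI, rule ccontr)
    fix b b' assume *: "b \<in> {..<k}" "b' \<in> {..<k}" "?r b = ?r b'" "b \<noteq> b'"
    then have "l b < l b' \<or> l b' < l b"
      using assms by (metis injD neqE)
    then show False
      using less[of b b'] less[of b' b] * by force
  qed
  have "?r ` {..<k} \<subseteq> {..<k}"
  proof (safe)
    fix b assume "b < k"
    then have "?r b < card {..<k}"
      by (intro psubset_card_mono) auto
    then show "?r b < k" by simp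
  qed
  then have "?r ` {..<k} = {..<k}"
    by (rule endo_inj_surj[OF finite_lessThan _ inj])
  with inj show ?thesis by (simp add: bij_betw_def)
qed

lemma mtf_cost_cong:
  assumes "\<And>m. 1 \<le> m \<Longrightarrow> m \<le> n \<Longrightarrow> c m = c' m"
  shows "mtf_cost k n c = mtf_cost k n c'"
proof -
  have "mtf_rank k c j = mtf_rank k c' j" if "j \<in> {1..n}" for j
  proof -
    have "last_time c j a = last_time c' j a" for a
      using that assms by (intro last_time_cong) auto
    moreover have "c j = c' j" using that assms by auto
    ultimately show ?thesis by (simp add: mtf_rank_def)
  qed
  then show ?thesis by (simp add: mtf_cost_def)
qed

lemma sum_words_Suc:
  "(\<Sum>c\<in>words (Suc n) k. f c) = (\<Sum>c\<in>words n k. \<Sum>b<k. f (c(Suc n := b)))"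
proof -
  have eq: "words (Suc n) k = (\<lambda>(y, g). g(Suc n := y)) ` ({..<k} \<times> words n k)"
    by (simp add: words_def atLeastAtMostSuc_conv PiE_insert_eq)
  have inj: "inj_on (\<lambda>(y, g). g(Suc n := y)) ({..<k} \<times> words n k)"
    unfolding words_def by (rule inj_combinator) simp
  have "(\<Sum>c\<in>words (Suc n) k. f c) = (\<Sum>(b, c)\<in>{..<k} \<times> words n k. f (c(Suc n := b)))"
    unfolding eq sum.reindex[OF inj] by (simp add: case_prod_unfold)
  also have "\<dots> = (\<Sum>b<k. \<Sum>c\<in>words n k. f (c(Suc n := b)))"
    by (simp add: sum.cartesian_product)
  finally show ?thesis by (simp add: sum.swap[of _ "words n k"])
qed

text \<open>
  The rank of the last letter ranges over \<open>{..<k}\<close> exactly once when that letter does, for every fixed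
  beginning of the word. Hence averaging over words is averaging over independent uniform ranks.
\<close>

lemma sum_mtf_cost_Suc:
  "(\<Sum>c\<in>words (Suc n) k. g (mtf_cost k (Suc n) c)) =
   (\<Sum>c\<in>words n k. \<Sum>r<k. g (mtf_cost k n c + r))"
proof -
  have "(\<Sum>b<k. g (mtf_cost k (Suc n) (c(Suc n := b)))) = (\<Sum>r<k. g (mtf_cost k n c + r))" for c
  proof -
    have "mtf_cost k (Suc n) (c(Suc n := b)) = mtf_cost k n c +
            card {a\<in>{..<k}. last_time c (Suc n) b < last_time c (Suc n) a}" for b
    proof -
      have "mtf_cost k n (c(Suc n := b)) = mtf_cost k n c"
        by (rule mtf_cost_cong) auto
      moreover have "last_time (c(Suc n := b)) (Suc n) a = last_time c (Suc n) a" for a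
        by (rule last_time_cong) auto
      ultimately show ?thesis
        by (simp add: mtf_cost_def mtf_rank_def)
    qed
    then show ?thesis
      using sum.reindex_bij_betw[OF bij_betw_rank[OF inj_last_time[of c "Suc n"], of k],
          of "\<lambda>r. g (mtf_cost k n c + r)"] by simp
  qed
  then show ?thesis by (simp add: sum_words_Suc)
qed

section \<open>Crossings and the move-to-front cost\<close>

definition color_classes :: "nat \<Rightarrow> nat \<Rightarrow> (nat \<Rightarrow> nat) \<Rightarrow> nat set set" where
  "color_classes n k c = (\<lambda>a. {i\<in>{1..n}. c i = a}) ` {..<k}"

text \<open>
  These are the sides of the polygons other than the closing ones, that is, the chords of the linear
  representation.
\<close>

definition arcs :: "nat \<Rightarrow> (nat \<Rightarrow> nat) \<Rightarrow> (nat \<times> nat) set" where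
  "arcs n c = {(i, j). 1 \<le> i \<and> i < j \<and> j \<le> n \<and> c i = c j \<and> (\<forall>m. i < m \<and> m < j \<longrightarrow> c m \<noteq> c i)}"

definition crossing_pairs ::
  "(nat \<times> nat) set \<Rightarrow> (nat \<times> nat) set \<Rightarrow> ((nat \<times> nat) \<times> (nat \<times> nat)) set" where
  "crossing_pairs P Q = {((i, j), (i', j')) | i j i' j'.
     (i, j) \<in> P \<and> (i', j') \<in> Q \<and> i < i' \<and> i' < j \<and> j < j'}"

lemma consecutive_sorted_list_of_set:
  fixes B :: "nat set"
  assumes "finite B"
  defines "b \<equiv> sorted_list_of_set B"
  shows "{(b ! i, b ! Suc i) | i. Suc i < length b} =
    {(i, j). i \<in> B \<and> j \<in> B \<and> i < j \<and> (\<forall>m. i < m \<and> m < j \<longrightarrow> m \<notin> B)}"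
    (is "?L = ?R")
proof -
  have set: "set b = B" and sd: "sorted_wrt (<) b"
    using assms by (auto simp: strict_sorted_list_of_set)
  have mono: "b ! s < b ! t \<longleftrightarrow> s < t" if "s < length b" "t < length b" for s t
    using that sorted_wrt_nth_less[OF sd, of s t] sorted_wrt_nth_less[OF sd, of t s]
    by (cases s t rule: linorder_cases) auto
  show ?thesis
  proof (intro equalityI subsetI)
    fix x assume "x \<in> ?L"
    then obtain s where s: "x = (b ! s, b ! Suc s)" "Suc s < length b" by auto
    have "m \<notin> B" if "b ! s < m" "m < b ! Suc s" for m
    proof
      assume "m \<in> B"
      then obtain t where "t < length b" "m = b ! t"
        using set by (metis in_set_conv_nth)
      then show False using that s mono[of s t] mono[of t "Suc s"] by auto
    qed
    then show "x \<in> ?R"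
      using s set mono[of s "Suc s"] by (auto intro: nth_mem)
  next
    fix x assume "x \<in> ?R"
    then obtain i j where x: "x = (i, j)" "i \<in> B" "j \<in> B" "i < j"
      "\<And>m. i < m \<Longrightarrow> m < j \<Longrightarrow> m \<notin> B" by auto
    obtain s t where st: "s < length b" "i = b ! s" "t < length b" "j = b ! t"
      using x set by (metis in_set_conv_nth)
    have "s < t" using mono[of s t] st x by simp
    have "\<not> Suc s < t"
    proof
      assume "Suc s < t"
      then have "b ! Suc s \<notin> B"
        using x st mono[of s "Suc s"] mono[of "Suc s" t] by simp
      then show False
        using \<open>Suc s < t\<close> st(3) set by (metis Suc_lessD nth_mem less_trans)
    qed
    then have "t = Suc s" using \<open>s < t\<close> by simp
    then show "x \<in> ?L" using x st by auto
  qed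
qed

text \<open>
  Only the number of closing chords matters for the estimates below, since each of them takes part in
  few crossings.
\<close>

lemma circular_chords_color_classes:
  assumes "c \<in> {1..n} \<rightarrow> {..<k}"
  obtains K where "circular_chords (color_classes n k c) = arcs n c \<union> K" "finite K" "card K \<le> k"
proof -
  let ?B = "\<lambda>a. {i\<in>{1..n}. c i = a}"
  let ?closing = "\<lambda>a. let b = sorted_list_of_set (?B a); m = length b in (b ! 0, b ! (m - 1))"
  define K where "K = ?closing ` {a\<in>{..<k}. 3 \<le> card (?B a)}"
  have chords: "block_chords (?B a) =
      {(i, j). i \<in> ?B a \<and> j \<in> ?B a \<and> i < j \<and> (\<forall>m. i < m \<and> m < j \<longrightarrow> m \<notin> ?B a)} \<union>
      (if 3 \<le> card (?B a) then {?closing a} else {})" for a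
    unfolding block_chords_def Let_def
    by (subst consecutive_sorted_list_of_set) auto
  have "circular_chords (color_classes n k c) =
      (\<Union>a<k. {(i, j). i \<in> ?B a \<and> j \<in> ?B a \<and> i < j \<and> (\<forall>m. i < m \<and> m < j \<longrightarrow> m \<notin> ?B a)}) \<union>
      (\<Union>a<k. if 3 \<le> card (?B a) then {?closing a} else {})"
    unfolding circular_chords_def color_classes_def UN_simps(10) chords UN_Un_distrib ..
  also have "(\<Union>a<k. {(i, j). i \<in> ?B a \<and> j \<in> ?B a \<and> i < j \<and> (\<forall>m. i < m \<and> m < j \<longrightarrow> m \<notin> ?B a)}) = arcs n c"
    using assms by (fastforce simp: arcs_def)
  also have "(\<Union>a<k. if 3 \<le> card (?B a) then {?closing a} else {}) = K"
    by (auto simp: K_def)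
  finally have "circular_chords (color_classes n k c) = arcs n c \<union> K" .
  moreover have "finite K" by (simp add: K_def)
  moreover have "card K \<le> k"
    unfolding K_def
    by (rule order.trans[OF card_image_le]) (auto intro: order.trans[OF card_mono[of "{..<k}"]])
  ultimately show thesis by (rule that)
qed

text \<open>
  The arcs of one colour have disjoint interiors, so the colour and a point below it identify an arc.
\<close>

lemma arc_over_unique:
  assumes "(i, j) \<in> arcs n c" "(i', j') \<in> arcs n c" "c i = c i'"
    and "i < x" "x < j" "i' < x" "x < j'"
  shows "(i, j) = (i', j')"
proof -
  have gap: "c m \<noteq> c i" if "i < m" "m < j" for m
    using assms(1) that by (auto simp: arcs_def)
  have gap': "c m \<noteq> c i" if "i' < m" "m < j'" for m
    using assms(2,3) that by (auto simp: arcs_def)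
  have "c i = c j" "c i = c j'"
    using assms(1-3) by (auto simp: arcs_def)
  then have "\<not> i < i'" "\<not> i' < i" "i = i' \<Longrightarrow> \<not> j < j'" "i = i' \<Longrightarrow> \<not> j' < j"
    using gap[of i'] gap'[of i] gap'[of j] gap[of j'] assms(3-7) by auto
  then show ?thesis by (metis linorder_neqE_nat)
qed

lemma finite_arcs: "finite (arcs n c)"
  by (rule finite_subset[of _ "{1..n} \<times> {1..n}"]) (auto simp: arcs_def)

text \<open>
  An arc that crosses a given chord passes over a prescribed end point of that chord, so it is
  determined by the chord and its own colour.
\<close>

lemma card_crossings_with_few:
  assumes c: "c \<in> {1..n} \<rightarrow> {..<k}" and K: "finite K" "card K \<le> k"
  shows "card (crossing_pairs K (arcs n c)) \<le> k\<^sup>2" "card (crossing_pairs (arcs n c) K) \<le> k\<^sup>2"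
    "card (crossing_pairs K K) \<le> k\<^sup>2"
proof -
  have fin: "finite (K \<times> {..<k})" and card: "card (K \<times> {..<k}) \<le> k\<^sup>2" "card (K \<times> K) \<le> k\<^sup>2"
    using K by (auto simp: card_cartesian_product power2_eq_square mult_le_mono)
  have arc_color: "c i < k" if "(i, j) \<in> arcs n c" for i j
    using that c by (auto simp: arcs_def Pi_iff)
  have "card (crossing_pairs K (arcs n c)) \<le> card (K \<times> {..<k})"
  proof (rule card_inj_on_le[where f = "\<lambda>(p, q). (p, c (fst q))", OF _ _ fin])
    show "inj_on (\<lambda>(p, q). (p, c (fst q))) (crossing_pairs K (arcs n c))"
      by (rule inj_onI) (auto simp: crossing_pairs_def dest: arc_over_unique)
  qed (auto simp: crossing_pairs_def dest: arc_color)
  then show "card (crossing_pairs K (arcs n c)) \<le> k\<^sup>2" using card by linarith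
  have "card (crossing_pairs (arcs n c) K) \<le> card (K \<times> {..<k})"
  proof (rule card_inj_on_le[where f = "\<lambda>(p, q). (q, c (fst p))", OF _ _ fin])
    show "inj_on (\<lambda>(p, q). (q, c (fst p))) (crossing_pairs (arcs n c) K)"
      by (rule inj_onI) (auto simp: crossing_pairs_def dest: arc_over_unique)
  qed (auto simp: crossing_pairs_def dest: arc_color)
  then show "card (crossing_pairs (arcs n c) K) \<le> k\<^sup>2" using card by linarith
  have "card (crossing_pairs K K) \<le> card (K \<times> K)"
    using K by (intro card_mono) (auto simp: crossing_pairs_def)
  then show "card (crossing_pairs K K) \<le> k\<^sup>2" using card by linarith
qed

lemma circular_crossings_bounds:
  assumes c: "c \<in> {1..n} \<rightarrow> {..<k}"
  shows "card (crossing_pairs (arcs n c) (arcs n c)) \<le> circular_crossings (color_classes n k c)"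
    and "circular_crossings (color_classes n k c) \<le> card (crossing_pairs (arcs n c) (arcs n c)) + 3 * k\<^sup>2"
proof -
  obtain K where K: "circular_chords (color_classes n k c) = arcs n c \<union> K" "finite K" "card K \<le> k"
    using circular_chords_color_classes[OF c] .
  let ?A = "arcs n c"
  have eq: "circular_crossings (color_classes n k c) = card (crossing_pairs (?A \<union> K) (?A \<union> K))"
    by (simp add: circular_crossings_def crossing_pairs_def K(1))
  have split: "crossing_pairs (?A \<union> K) (?A \<union> K) = crossing_pairs ?A ?A \<union>
      (crossing_pairs K ?A \<union> (crossing_pairs ?A K \<union> crossing_pairs K K))"
    by (auto simp: crossing_pairs_def)
  have "finite (crossing_pairs (?A \<union> K) (?A \<union> K))"
    by (rule finite_subset[of _ "(?A \<union> K) \<times> (?A \<union> K)"])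
       (use K finite_arcs in \<open>auto simp: crossing_pairs_def\<close>)
  then show "card (crossing_pairs ?A ?A) \<le> circular_crossings (color_classes n k c)"
    unfolding eq by (rule card_mono) (auto simp: crossing_pairs_def)
  have "card (crossing_pairs (?A \<union> K) (?A \<union> K)) \<le> card (crossing_pairs ?A ?A) +
      (card (crossing_pairs K ?A) + (card (crossing_pairs ?A K) + card (crossing_pairs K K)))"
    unfolding split
    by (intro order.trans[OF card_Un_le] add_mono order.refl)
  then show "circular_crossings (color_classes n k c) \<le> card (crossing_pairs ?A ?A) + 3 * k\<^sup>2"
    unfolding eq using card_crossings_with_few[OF c K(2,3)] by linarith
qed

text \<open>
  The cost counts pairs of a position \<open>j\<close> and a letter \<open>a\<close> that has been read more recently than
  \<open>c j\<close>. If \<open>c j\<close> has been read before and \<open>a\<close> is read again, then the arc ending at \<open>j\<close> and the arc of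
  colour \<open>a\<close> over \<open>j\<close> cross, and all crossings of arcs arise in this way. The other pairs are determined by
  the two letters involved.
\<close>

lemma mtf_cost_arc_crossings:
  assumes c: "c \<in> {1..n} \<rightarrow> {..<k}"
  shows "card (crossing_pairs (arcs n c) (arcs n c)) \<le> mtf_cost k n c"
    and "mtf_cost k n c \<le> card (crossing_pairs (arcs n c) (arcs n c)) + 2 * k\<^sup>2"
proof -
  let ?A = "arcs n c"
  define T where "T = (SIGMA j:{1..n}. {a\<in>{..<k}. last_time c j (c j) < last_time c j a})"
  \<comment> \<open>A pair in \<open>T1\<close> is determined by its letters because \<open>j\<close> is the first occurrence of \<open>c j\<close>.\<close>
  define T1 where "T1 = {(j, a) \<in> T. \<forall>m\<in>{1..<j}. c m \<noteq> c j}"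
  \<comment> \<open>A pair in \<open>T2\<close> is determined by its letters because \<open>j\<close> is the first occurrence of \<open>c j\<close> after the last one of \<open>a\<close>.\<close>
  define T2 where "T2 = {(j, a) \<in> T. (\<exists>m\<in>{1..<j}. c m = c j) \<and> (\<forall>m\<in>{j..n}. c m \<noteq> a)}"
  define T3 where "T3 = {(j, a) \<in> T. (\<exists>m\<in>{1..<j}. c m = c j) \<and> (\<exists>m\<in>{j..n}. c m = a)}"
  have fin: "finite T" by (simp add: T_def)
  have cost: "mtf_cost k n c = card T"
    by (simp add: mtf_cost_def mtf_rank_def T_def)
  have T: "T = T3 \<union> (T1 \<union> T2)"
    unfolding T1_def T2_def T3_def by auto
  have lt: "c j < k" if "j \<in> {1..n}" for j using c that by auto
  have T1: "card T1 \<le> k\<^sup>2"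
  proof -
    have "card T1 \<le> card ({..<k} \<times> {..<k})"
    proof (rule card_inj_on_le[where f = "\<lambda>(j, a). (c j, a)"])
      show "inj_on (\<lambda>(j, a). (c j, a)) T1"
      proof (rule inj_onI, clarsimp)
        fix j j' a assume *: "(j, a) \<in> T1" "(j', a) \<in> T1" "c j = c j'"
        then have "\<not> j < j'" "\<not> j' < j" by (auto simp: T1_def T_def)
        then show "j = j'" by simp
      qed
    qed (auto simp: T1_def T_def lt)
    then show ?thesis by (simp add: card_cartesian_product power2_eq_square)
  qed
  have T2: "card T2 \<le> k\<^sup>2"
  proof -
    have no: "\<not> j < j'" if "(j, a) \<in> T2" "(j', a) \<in> T2" "c j = c j'" for j j' a
    proof
      assume "j < j'"
      have j: "1 \<le> j" "j' \<le> n" and ltj: "last_time c j (c j) < last_time c j a"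
        "last_time c j' (c j) < last_time c j' a" and ex: "\<exists>m\<in>{1..<j}. c m = c j"
        and last: "\<forall>m\<in>{j..n}. c m \<noteq> a"
        using that by (auto simp: T2_def T_def)
      have "0 < last_time c j (c j)" using ex last_time_pos_iff by blast
      with ltj have "0 < last_time c j a" by linarith
      then obtain m where m: "m \<in> {1..<j}" "c m = a" using last_time_pos_iff by blast
      obtain i where i: "1 \<le> i" "i < j" "c i = a" "\<And>m. i < m \<Longrightarrow> m < j \<Longrightarrow> c m \<noteq> a"
        using last_time_obtain[of m j c a, OF m] by metis
      have "last_time c j' a = int i"
      proof (rule last_time_eqI)
        show "c m \<noteq> a" if "i < m" "m < j'" for m
          using that i(4)[of m] last j by (cases "m < j") auto
      qed (use i \<open>j < j'\<close> in auto)
      moreover have "j \<in> {1..<j'}" using j \<open>j < j'\<close> by auto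
      then obtain i' where i': "last_time c j' (c j) = int i'" "i' < j'" "\<And>m. i' < m \<Longrightarrow> m < j' \<Longrightarrow> c m \<noteq> c j"
        using last_time_obtain[of j j' c "c j"] by metis
      then have "j \<le> i'"
        using \<open>j < j'\<close> by (metis not_less)
      ultimately show False using ltj i' i by simp
    qed
    have "card T2 \<le> card ({..<k} \<times> {..<k})"
    proof (rule card_inj_on_le[where f = "\<lambda>(j, a). (c j, a)"])
      show "inj_on (\<lambda>(j, a). (c j, a)) T2"
      proof (rule inj_onI, clarsimp)
        fix j j' a assume *: "(j, a) \<in> T2" "(j', a) \<in> T2" "c j = c j'"
        show "j = j'"
          using no[OF *] no[OF *(2,1) *(3)[symmetric]] by simp
      qed
    qed (auto simp: T2_def T_def lt)
    then show ?thesis by (simp add: card_cartesian_product power2_eq_square)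
  qed
  have T3: "card (crossing_pairs ?A ?A) = card T3"
  proof (rule bij_betw_same_card)
    let ?f = "\<lambda>(p, q). (snd p, c (fst q))"
    have inj: "inj_on ?f (crossing_pairs ?A ?A)"
    proof (rule inj_onI)
      fix x y assume x: "x \<in> crossing_pairs ?A ?A" and y: "y \<in> crossing_pairs ?A ?A"
        and eq: "?f x = ?f y"
      obtain i j i' j' where x': "x = ((i, j), (i', j'))" "(i, j) \<in> ?A" "(i', j') \<in> ?A"
        "i < i'" "i' < j" "j < j'" using x by (auto simp: crossing_pairs_def)
      obtain u v u' v' where y': "y = ((u, v), (u', v'))" "(u, v) \<in> ?A" "(u', v') \<in> ?A"
        "u < u'" "u' < v" "v < v'" using y by (auto simp: crossing_pairs_def)
      have e: "j = v" "c i' = c u'" using eq x' y' by auto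
      have "(i', j') = (u', v')"
        by (rule arc_over_unique[where x = j and n = n and c = c]) (use x' y' e in auto)
      moreover have "\<not> i < u" "\<not> u < i"
        using x' y' e by (auto simp: arcs_def)
      ultimately show "x = y" using x' y' e by auto
    qed
    moreover have "?f ` crossing_pairs ?A ?A = T3"
    proof (intro equalityI subsetI)
      fix z assume "z \<in> ?f ` crossing_pairs ?A ?A"
      then obtain i j i' j' where z: "z = (j, c i')" "(i, j) \<in> ?A" "(i', j') \<in> ?A"
        "i < i'" "i' < j" "j < j'" by (auto simp: crossing_pairs_def)
      have "last_time c j (c j) = int i"
        by (rule last_time_eqI) (use z in \<open>auto simp: arcs_def\<close>)
      moreover have "last_time c j (c i') = int i'"
        by (rule last_time_eqI) (use z in \<open>auto simp: arcs_def\<close>)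
      moreover have "i \<in> {1..<j}" "c i = c j" "j' \<in> {j..n}" "c j' = c i'" "j \<in> {1..n}" "i' \<in> {1..n}"
        using z by (auto simp: arcs_def)
      ultimately have "(j, c i') \<in> T" "\<exists>m\<in>{1..<j}. c m = c j" "\<exists>m\<in>{j..n}. c m = c i'"
        using z(4) lt[of i'] by (simp add: T_def, blast+)
      then show "z \<in> T3"
        unfolding T3_def z(1) by simp
    next
      fix z assume z: "z \<in> T3"
      then obtain j a where ja: "z = (j, a)" by (cases z)
      have j: "1 \<le> j" "j \<le> n" "a < k" and ltj: "last_time c j (c j) < last_time c j a"
        and ex: "\<exists>m\<in>{1..<j}. c m = c j" and ex': "\<exists>m\<in>{j..n}. c m = a"
        using z ja by (auto simp: T3_def T_def)
      obtain i where i: "1 \<le> i" "i < j" "c i = c j" "\<And>m. i < m \<Longrightarrow> m < j \<Longrightarrow> c m \<noteq> c j"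
        "last_time c j (c j) = int i"
        using ex last_time_obtain[of _ j c "c j"] by metis
      have "0 < last_time c j a" using ltj i by linarith
      then obtain m where m: "m \<in> {1..<j}" "c m = a" using last_time_pos_iff by blast
      obtain i' where i': "1 \<le> i'" "i' < j" "c i' = a" "\<And>m. i' < m \<Longrightarrow> m < j \<Longrightarrow> c m \<noteq> a"
        "last_time c j a = int i'"
        using last_time_obtain[of m j c a, OF m] by metis
      define j' where "j' = (LEAST m. j \<le> m \<and> m \<le> n \<and> c m = a)"
      have j': "j \<le> j' \<and> j' \<le> n \<and> c j' = a"
        unfolding j'_def by (rule LeastI_ex) (use ex' in auto)
      have least: "c m \<noteq> a" if "j \<le> m" "m < j'" for m
        using that not_less_Least[of m "\<lambda>m. j \<le> m \<and> m \<le> n \<and> c m = a"] j'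
        unfolding j'_def[symmetric] by auto
      have "j \<noteq> j'" using j' ltj by auto
      have "(i', j') \<in> ?A"
        using i' j' least unfolding arcs_def
        by (auto simp: not_less) (metis not_less)
      moreover have "(i, j) \<in> ?A" using i j by (auto simp: arcs_def)
      moreover have "i < i'" using ltj i i' by simp
      ultimately have "((i, j), (i', j')) \<in> crossing_pairs ?A ?A"
        using i' j' \<open>j \<noteq> j'\<close> unfolding crossing_pairs_def by auto
      moreover have "?f ((i, j), (i', j')) = z" using ja i' by simp
      ultimately show "z \<in> ?f ` crossing_pairs ?A ?A" by force
    qed
    ultimately show "bij_betw ?f (crossing_pairs ?A ?A) T3"
      by (simp add: bij_betw_def)
  qed
  show "card (crossing_pairs ?A ?A) \<le> mtf_cost k n c"
    unfolding T3 cost using fin T by (metis Un_upper1 card_mono)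
  have "card T \<le> card T3 + (card T1 + card T2)"
    unfolding T by (intro order.trans[OF card_Un_le] add_mono order.refl)
  then show "mtf_cost k n c \<le> card (crossing_pairs ?A ?A) + 2 * k\<^sup>2"
    unfolding T3 cost using T1 T2 by linarith
qed

lemma crossings_mtf_cost:
  assumes "c \<in> {1..n} \<rightarrow> {..<k}"
  shows "\<bar>crossings_rv (color_classes n k c) - real (mtf_cost k n c)\<bar> \<le> 3 * (real k)\<^sup>2"
proof -
  have "circular_crossings (color_classes n k c) \<le> mtf_cost k n c + 3 * k\<^sup>2"
    "mtf_cost k n c \<le> circular_crossings (color_classes n k c) + 3 * k\<^sup>2"
    using circular_crossings_bounds[OF assms] mtf_cost_arc_crossings[OF assms] by linarith+
  then have "real (circular_crossings (color_classes n k c)) \<le> real (mtf_cost k n c + 3 * k\<^sup>2)"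
    "real (mtf_cost k n c) \<le> real (circular_crossings (color_classes n k c) + 3 * k\<^sup>2)"
    by (simp_all only: of_nat_le_iff)
  then show ?thesis by (simp add: crossings_rv_def)
qed

section \<open>Set partitions as surjective words\<close>

definition surj_words :: "nat \<Rightarrow> nat \<Rightarrow> (nat \<Rightarrow> nat) set" where
  "surj_words n k = {c \<in> words n k. c ` {1..n} = {..<k}}"

lemma finite_surj_words: "finite (surj_words n k)"
  using finite_words by (simp add: surj_words_def)

lemma color_classes_eq_iff:
  assumes "c \<in> words n k" "i \<in> {1..n}" "i' \<in> {1..n}"
  shows "c i = c i' \<longleftrightarrow> (\<exists>B\<in>color_classes n k c. i \<in> B \<and> i' \<in> B)"
proof -
  have "c i < k" using assms by (auto simp: words_def)
  then show ?thesis using assms by (auto simp: color_classes_def)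
qed

lemma color_classes_set_partitions:
  assumes "c \<in> surj_words n k"
  shows "color_classes n k c \<in> set_partitions n k"
proof -
  have ne: "\<exists>i\<in>{1..n}. c i = a" if "a < k" for a
  proof -
    have "a \<in> c ` {1..n}" using assms that by (simp add: surj_words_def)
    then show ?thesis by blast
  qed
  have lt: "c i < k" if "i \<in> {1..n}" for i
    using assms that by (auto simp: surj_words_def words_def)
  have "inj_on (\<lambda>a. {i\<in>{1..n}. c i = a}) {..<k}"
    using ne by (intro inj_onI) blast
  then have "card (color_classes n k c) = k"
    by (simp add: color_classes_def card_image)
  moreover have "partition_on {1..n} (color_classes n k c)"
    unfolding partition_on_def
  proof (intro conjI)
    show "\<Union> (color_classes n k c) = {1..n}"
      using lt by (auto simp: color_classes_def)
    show "disjoint (color_classes n k c)"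
      by (auto simp: disjoint_def color_classes_def)
    show "{} \<notin> color_classes n k c"
    proof
      assume "{} \<in> color_classes n k c"
      then obtain a where "a < k" "{i\<in>{1..n}. c i = a} = {}"
        by (auto simp: color_classes_def)
      then show False using ne[of a] by blast
    qed
  qed
  ultimately show ?thesis by (simp add: set_partitions_def)
qed

lemma ex_surj_word_color_classes:
  assumes "\<pi> \<in> set_partitions n k"
  shows "\<exists>c\<in>surj_words n k. color_classes n k c = \<pi>"
proof -
  have part: "partition_on {1..n} \<pi>" and card: "card \<pi> = k"
    using assms by (auto simp: set_partitions_def)
  have "finite \<pi>"
    using finite_elements[OF _ part] by simp
  then obtain e where e: "bij_betw e {..<k} \<pi>"
    using ex_bij_betw_nat_finite card by (metis atLeast0LessThan)
  have dis: "a = b" if "a < k" "b < k" "i \<in> e a" "i \<in> e b" for a b i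
  proof -
    have "e a \<in> \<pi>" "e b \<in> \<pi>" using e that by (auto simp: bij_betw_def)
    then have "e a = e b"
      using part that unfolding partition_on_def disjoint_def by blast
    then show ?thesis using e that by (auto simp: bij_betw_def inj_on_def)
  qed
  have cover: "\<exists>a<k. i \<in> e a" if "i \<in> {1..n}" for i
  proof -
    have "i \<in> \<Union>\<pi>" using part that by (simp add: partition_on_def)
    also have "\<pi> = e ` {..<k}" using e by (simp add: bij_betw_def)
    finally show ?thesis by auto
  qed
  define c where "c = (\<lambda>i\<in>{1..n}. SOME a. a < k \<and> i \<in> e a)"
  have c: "c i < k \<and> i \<in> e (c i)" if "i \<in> {1..n}" for i
    using someI_ex[OF cover[OF that, unfolded Bex_def]] that by (simp add: c_def)
  have sub: "e a \<subseteq> {1..n}" "e a \<noteq> {}" if "a < k" for a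
    using part e that unfolding partition_on_def bij_betw_def by blast+
  have cls: "{i\<in>{1..n}. c i = a} = e a" if "a < k" for a
    using sub[OF that] c dis that by blast
  have "c \<in> words n k"
    using c by (auto simp: words_def c_def)
  moreover have "c ` {1..n} = {..<k}"
  proof
    show "c ` {1..n} \<subseteq> {..<k}" using c by auto
    show "{..<k} \<subseteq> c ` {1..n}"
    proof
      fix a assume "a \<in> {..<k}"
      then obtain i where "i \<in> {i\<in>{1..n}. c i = a}"
        using cls[of a] sub(2)[of a] by auto
      then show "a \<in> c ` {1..n}" by auto
    qed
  qed
  moreover have "color_classes n k c = \<pi>"
    using cls e by (simp add: color_classes_def bij_betw_def)
  ultimately show ?thesis by (auto simp: surj_words_def)
qed

text \<open>
  The words with the same colour classes as \<open>c0\<close> arise from \<open>c0\<close> by permuting the letters.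
\<close>

lemma card_surj_words_fiber:
  assumes c0: "c0 \<in> surj_words n k"
  shows "card {c \<in> surj_words n k. color_classes n k c = color_classes n k c0} = fact k"
proof -
  let ?F = "{c \<in> surj_words n k. color_classes n k c = color_classes n k c0}"
  let ?h = "\<lambda>\<sigma>. \<lambda>i\<in>{1..n}. \<sigma> (c0 i)"
  have ran0: "c0 ` {1..n} = {..<k}" and w0: "c0 \<in> words n k"
    using c0 by (auto simp: surj_words_def)
  have inj: "inj_on ?h {\<sigma>. \<sigma> permutes {..<k}}"
  proof (rule inj_onI, rule ext)
    fix \<sigma> \<tau> a assume *: "\<sigma> \<in> {\<sigma>. \<sigma> permutes {..<k}}" "\<tau> \<in> {\<sigma>. \<sigma> permutes {..<k}}" "?h \<sigma> = ?h \<tau>"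
    show "\<sigma> a = \<tau> a"
    proof (cases "a < k")
      case True
      then obtain i where "i \<in> {1..n}" "c0 i = a" using ran0 by (metis imageE lessThan_iff)
      then show ?thesis using fun_cong[OF *(3), of i] by simp
    next
      case False
      then show ?thesis using * by (simp add: permutes_not_in)
    qed
  qed
  have "?h ` {\<sigma>. \<sigma> permutes {..<k}} = ?F"
  proof (intro equalityI subsetI)
    fix c assume "c \<in> ?h ` {\<sigma>. \<sigma> permutes {..<k}}"
    then obtain \<sigma> where \<sigma>: "\<sigma> permutes {..<k}" and c: "c = ?h \<sigma>" by blast
    have im: "c ` {1..n} = {..<k}"
      using permutes_image[OF \<sigma>] ran0 unfolding c by (metis (no_types, lifting) image_cong image_image restrict_apply')
    then have "c \<in> words n k"
      using c by (auto simp: words_def)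
    moreover have "color_classes n k c = color_classes n k c0"
    proof -
      have "{i\<in>{1..n}. c i = \<sigma> a} = {i\<in>{1..n}. c0 i = a}" for a
        using permutes_inj[OF \<sigma>] by (auto simp: c inj_eq)
      then have "color_classes n k c0 = (\<lambda>a. {i\<in>{1..n}. c i = a}) ` (\<sigma> ` {..<k})"
        by (simp add: color_classes_def image_image)
      then show ?thesis using permutes_image[OF \<sigma>] by (simp add: color_classes_def)
    qed
    ultimately show "c \<in> ?F" using im by (simp add: surj_words_def)
  next
    fix c assume "c \<in> ?F"
    then have ran: "c ` {1..n} = {..<k}" and w: "c \<in> words n k"
      and eq: "color_classes n k c = color_classes n k c0"
      by (auto simp: surj_words_def)
    have iff: "c i = c i' \<longleftrightarrow> c0 i = c0 i'" if "i \<in> {1..n}" "i' \<in> {1..n}" for i i'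
      using color_classes_eq_iff[OF w that] color_classes_eq_iff[OF w0 that] eq by simp
    define \<sigma> where "\<sigma> = (\<lambda>a. if a < k then c (SOME i. i \<in> {1..n} \<and> c0 i = a) else a)"
    have \<sigma>: "\<sigma> (c0 i) = c i" if "i \<in> {1..n}" for i
    proof -
      have "c0 i < k" using w0 that by (auto simp: words_def)
      moreover have "(SOME i'. i' \<in> {1..n} \<and> c0 i' = c0 i) \<in> {1..n} \<and>
        c0 (SOME i'. i' \<in> {1..n} \<and> c0 i' = c0 i) = c0 i"
        by (rule someI[where x = i]) (use that in simp)
      ultimately show ?thesis using iff that by (simp add: \<sigma>_def)
    qed
    have "\<sigma> ` c0 ` {1..n} = c ` {1..n}"
      unfolding image_image using \<sigma> by (rule image_cong[OF refl])
    then have "\<sigma> ` {..<k} = {..<k}"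
      unfolding ran ran0 .
    then have "bij_betw \<sigma> {..<k} {..<k}"
      by (simp add: bij_betw_def eq_card_imp_inj_on)
    then have "\<sigma> permutes {..<k}"
      by (rule bij_imp_permutes) (simp add: \<sigma>_def)
    moreover have "c = ?h \<sigma>"
      using \<sigma> w by (auto simp: words_def fun_eq_iff PiE_def extensional_def)
    ultimately show "c \<in> ?h ` {\<sigma>. \<sigma> permutes {..<k}}" by blast
  qed
  then have "card ?F = card {\<sigma>. \<sigma> permutes {..<k}}"
    using card_image[OF inj] by simp
  then show ?thesis by (simp add: card_permutations)
qed

lemma map_pmf_of_set_equal_fibers:
  assumes "finite A" "A \<noteq> {}" "f ` A = B" "\<And>b. b \<in> B \<Longrightarrow> card {a\<in>A. f a = b} = N"
  shows "map_pmf f (pmf_of_set A) = pmf_of_set B"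
proof (rule pmf_eqI)
  fix b
  have B: "finite B" "B \<noteq> {}" using assms by auto
  have "card A = (\<Sum>b\<in>B. card {a\<in>A. f a = b})"
    using sum.group[OF assms(1) B(1), of f "\<lambda>_. 1::nat"] assms(3) by simp
  then have card: "card A = card B * N" using assms(4) by simp
  then have "N \<noteq> 0" using assms(1,2) by (metis card_eq_0_iff mult_0_right)
  have "A \<inter> f -` {b} = {a\<in>A. f a = b}" by auto
  then have "pmf (map_pmf f (pmf_of_set A)) b = card {a\<in>A. f a = b} / card A"
    using assms(1,2) by (simp add: pmf_map measure_pmf_of_set)
  also have "\<dots> = pmf (pmf_of_set B) b"
  proof (cases "b \<in> B")
    case True
    then show ?thesis using B card \<open>N \<noteq> 0\<close> assms(4) by simp
  next
    case False
    then have none: "{a\<in>A. f a = b} = {}" using assms(3) by auto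
    show ?thesis unfolding none using False B by simp
  qed
  finally show "pmf (map_pmf f (pmf_of_set A)) b = pmf (pmf_of_set B) b" .
qed

lemma image_color_classes: "color_classes n k ` surj_words n k = set_partitions n k"
  using color_classes_set_partitions ex_surj_word_color_classes by blast

lemma surj_words_nonempty:
  assumes "1 \<le> k" "k \<le> n"
  shows "surj_words n k \<noteq> {}"
  using set_partitions_nonempty[OF assms] image_color_classes[of n k] by auto

lemma partition_pmf_eq_map_surj_words:
  assumes "1 \<le> k" "k \<le> n"
  shows "partition_pmf n k = map_pmf (color_classes n k) (pmf_of_set (surj_words n k))"
proof -
  have "map_pmf (color_classes n k) (pmf_of_set (surj_words n k)) = pmf_of_set (set_partitions n k)"
  proof (rule map_pmf_of_set_equal_fibers[where N = "fact k"])
    show "card {c \<in> surj_words n k. color_classes n k c = \<pi>} = fact k"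
      if \<pi>: "\<pi> \<in> set_partitions n k" for \<pi>
    proof -
      obtain c0 where "c0 \<in> surj_words n k" "color_classes n k c0 = \<pi>"
        using ex_surj_word_color_classes[OF \<pi>] by blast
      then show ?thesis using card_surj_words_fiber[of c0 n k] by simp
    qed
  qed (use finite_surj_words surj_words_nonempty[OF assms] image_color_classes in auto)
  then show ?thesis by (simp add: partition_pmf_def)
qed

text \<open>
  The union bound over the missing letter gives \<open>k * (1 - 1 / k)^n\<close>.
\<close>

lemma card_nonsurj_words:
  assumes "1 \<le> k"
  shows "real (card (words n k - surj_words n k)) / real (card (words n k)) \<le> real k * exp (- (real n / real k))"
proof -
  have "words n k - surj_words n k \<subseteq> (\<Union>a<k. {1..n} \<rightarrow>\<^sub>E ({..<k} - {a}))"
  proof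
    fix c assume "c \<in> words n k - surj_words n k"
    then have c: "c \<in> {1..n} \<rightarrow>\<^sub>E {..<k}" "c ` {1..n} \<noteq> {..<k}"
      by (auto simp: words_def surj_words_def)
    then obtain a where "a < k" "a \<notin> c ` {1..n}" by (auto simp: PiE_iff)
    then show "c \<in> (\<Union>a<k. {1..n} \<rightarrow>\<^sub>E ({..<k} - {a}))"
      using c(1) by (intro UN_I[of a]) (auto simp: PiE_iff)
  qed
  then have "card (words n k - surj_words n k) \<le> card (\<Union>a<k. {1..n} \<rightarrow>\<^sub>E ({..<k} - {a}))"
    by (intro card_mono finite_UN_I finite_PiE) auto
  also have "\<dots> \<le> (\<Sum>a<k. card ({1..n} \<rightarrow>\<^sub>E ({..<k} - {a})))"
    by (rule card_UN_le) simp
  also have "\<dots> = k * (k - 1) ^ n"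
    by (simp add: card_PiE)
  finally have "real (card (words n k - surj_words n k)) \<le> real (k * (k - 1) ^ n)"
    by (simp only: of_nat_le_iff)
  also have "\<dots> = real k * (real k - 1) ^ n"
    using assms by (simp add: of_nat_diff)
  finally have "real (card (words n k - surj_words n k)) / real k ^ n \<le> real k * (real k - 1) ^ n / real k ^ n"
    by (rule divide_right_mono) simp
  also have "\<dots> = real k * (1 + - 1 / real k) ^ n"
  proof -
    have "1 + - 1 / real k = (real k - 1) / real k"
      using assms by (simp add: field_simps)
    then show ?thesis by (simp add: power_divide)
  qed
  also have "\<dots> \<le> real k * exp (- 1 / real k) ^ n"
    using assms by (intro mult_left_mono power_mono exp_ge_add_one_self) auto
  also have "exp (- 1 / real k) ^ n = exp (- (real n / real k))"
    by (simp add: exp_of_nat_mult[symmetric])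
  finally show ?thesis by (simp add: card_words)
qed

lemma expectation_pmf_of_set:
  fixes f :: "'a \<Rightarrow> 'b::{banach, second_countable_topology}"
  assumes "finite A" "A \<noteq> {}"
  shows "measure_pmf.expectation (pmf_of_set A) f = (1 / real (card A)) *\<^sub>R (\<Sum>a\<in>A. f a)"
  using assms by (subst integral_measure_pmf[of A]) (auto simp: scaleR_sum_right)

lemma expectation_subset_close:
  fixes f :: "'a \<Rightarrow> 'b::{banach, second_countable_topology}"
  assumes A: "finite A" and S: "S \<subseteq> A" "S \<noteq> {}" and M: "\<And>a. a \<in> A \<Longrightarrow> norm (f a) \<le> M"
  shows "norm (measure_pmf.expectation (pmf_of_set S) f - measure_pmf.expectation (pmf_of_set A) f)
           \<le> 2 * M * (real (card (A - S)) / real (card A))"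
proof -
  have fS: "finite S" using A S finite_subset by blast
  let ?s = "real (card S)" and ?a = "real (card A)"
  have pos: "0 < ?s" "0 < ?a" and le: "?s \<le> ?a"
    using A S fS card_mono[OF A S(1)] by (auto simp: card_gt_0_iff)
  have diff: "real (card (A - S)) = ?a - ?s"
    using S fS le by (simp add: card_Diff_subset of_nat_diff)
  have split: "(\<Sum>a\<in>A. f a) = (\<Sum>a\<in>S. f a) + (\<Sum>a\<in>A - S. f a)"
    using sum.subset_diff[OF S(1) A, of f] by (simp add: add.commute)
  have nS: "norm (\<Sum>a\<in>S. f a) \<le> ?s * M"
    using S M by (intro sum_norm_bound) auto
  have nD: "norm (\<Sum>a\<in>A - S. f a) \<le> (?a - ?s) * M"
    unfolding diff[symmetric] using M by (intro sum_norm_bound) auto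
  have "measure_pmf.expectation (pmf_of_set S) f - measure_pmf.expectation (pmf_of_set A) f
      = (1 / ?s - 1 / ?a) *\<^sub>R (\<Sum>a\<in>S. f a) - (1 / ?a) *\<^sub>R (\<Sum>a\<in>A - S. f a)"
    using A S fS by (subst (1 2) expectation_pmf_of_set) (auto simp: split algebra_simps)
  also have "norm \<dots> \<le> norm ((1 / ?s - 1 / ?a) *\<^sub>R (\<Sum>a\<in>S. f a)) + norm ((1 / ?a) *\<^sub>R (\<Sum>a\<in>A - S. f a))"
    by (rule norm_triangle_ineq4)
  also have "\<dots> = (1 / ?s - 1 / ?a) * norm (\<Sum>a\<in>S. f a) + (1 / ?a) * norm (\<Sum>a\<in>A - S. f a)"
    using pos le by (simp add: abs_of_nonneg frac_le)
  also have "\<dots> \<le> (1 / ?s - 1 / ?a) * (?s * M) + (1 / ?a) * ((?a - ?s) * M)"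
    using pos le nS nD by (intro add_mono mult_left_mono) (auto simp: frac_le)
  also have "\<dots> = 2 * M * ((?a - ?s) / ?a)"
    using pos by (simp add: field_simps)
  finally show ?thesis by (simp add: diff)
qed

text \<open>
  Conditioning on surjectivity changes the expectation of a bounded function by an exponentially small
  amount. This transfers the exact formulas for independent letters to random partitions.
\<close>

lemma expectation_surj_words_close:
  fixes f :: "(nat \<Rightarrow> nat) \<Rightarrow> 'b::{banach, second_countable_topology}"
  assumes "1 \<le> k" "k \<le> n" and M: "\<And>c. c \<in> words n k \<Longrightarrow> norm (f c) \<le> M"
  shows "norm (measure_pmf.expectation (pmf_of_set (surj_words n k)) f
             - measure_pmf.expectation (pmf_of_set (words n k)) f)
           \<le> 2 * M * (real k * exp (- (real n / real k)))"
proof -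
  have sub: "surj_words n k \<subseteq> words n k" by (auto simp: surj_words_def)
  have ne: "surj_words n k \<noteq> {}" by (rule surj_words_nonempty) fact+
  then obtain c where "c \<in> words n k" using sub by auto
  then have "0 \<le> M" using M[of c] by (meson norm_ge_zero order.trans)
  then have "2 * M * (real (card (words n k - surj_words n k)) / real (card (words n k)))
      \<le> 2 * M * (real k * exp (- (real n / real k)))"
    using card_nonsurj_words[OF assms(1)] by (intro mult_left_mono) auto
  then show ?thesis
    using expectation_subset_close[OF finite_words sub ne M] by (rule order.trans[rotated])
qed

section \<open>Exact moments of the cost\<close>

definition centered_cost :: "nat \<Rightarrow> nat \<Rightarrow> (nat \<Rightarrow> nat) \<Rightarrow> real" where
  "centered_cost n k c = real (mtf_cost k n c) - real n * ((real k - 1) / 2)"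

lemma sum_centered: "(\<Sum>r<k. real r - (real k - 1) / 2) = 0"
proof -
  have "2 * (\<Sum>r<k. real r) = real k * (real k - 1)"
    by (induction k) (auto simp: algebra_simps)
  then show ?thesis by (simp add: sum_subtractf)
qed

lemma sum_centered_square: "(\<Sum>r<k. (real r - (real k - 1) / 2)\<^sup>2) = real k * (((real k)\<^sup>2 - 1) / 12)"
proof -
  have 1: "(\<Sum>r<k. real r) = real k * (real k - 1) / 2"
    by (induction k) (auto simp: algebra_simps)
  have 2: "(\<Sum>r<k. (real r)\<^sup>2) = real k * (real k - 1) * (2 * real k - 1) / 6"
    by (induction k) (auto simp: field_simps power2_eq_square)
  have expand: "(\<Sum>r<k. (real r - \<mu>)\<^sup>2) = (\<Sum>r<k. (real r)\<^sup>2) - 2 * \<mu> * (\<Sum>r<k. real r) + real k * \<mu>\<^sup>2" for \<mu>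
    by (simp add: power2_diff sum.distrib sum_subtractf sum_distrib_left mult_ac)
  show ?thesis
    unfolding expand 1 2 by (simp add: field_simps power2_eq_square)
qed

lemma sum_centered_cost_Suc:
  "(\<Sum>c\<in>words (Suc n) k. g (centered_cost (Suc n) k c)) =
   (\<Sum>c\<in>words n k. \<Sum>r<k. g (centered_cost n k c + (real r - (real k - 1) / 2)))"
proof -
  have "real (x + r) - real (Suc n) * \<mu> = real x - real n * \<mu> + (real r - \<mu>)" for x r \<mu>
    by (simp add: algebra_simps)
  then show ?thesis
    unfolding centered_cost_def
    using sum_mtf_cost_Suc[where g = "\<lambda>x. g (real x - real (Suc n) * ((real k - 1) / 2))" and n = n and k = k]
    by presburger
qed

lemma words_0: "words 0 k = {\<lambda>_. undefined}"
  by (simp add: words_def)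

lemma centered_cost_0: "centered_cost 0 k c = 0"
  by (simp add: centered_cost_def mtf_cost_def)

lemma sum_centered_cost: "(\<Sum>c\<in>words n k. centered_cost n k c) = 0"
proof (induction n)
  case (Suc n)
  then show ?case
    using sum_centered_cost_Suc[where g = "\<lambda>x. x"]
    by (simp add: sum.distrib sum_centered flip: sum_distrib_left)
qed (simp add: words_0 centered_cost_0)

lemma sum_centered_cost_square:
  "(\<Sum>c\<in>words n k. (centered_cost n k c)\<^sup>2) = real k ^ n * (real n * (((real k)\<^sup>2 - 1) / 12))"
proof (induction n)
  case (Suc n)
  have "(\<Sum>r<k. (x + (real r - (real k - 1) / 2))\<^sup>2) = real k * x\<^sup>2 + real k * (((real k)\<^sup>2 - 1) / 12)" for x
  proof -
    have "(\<Sum>r<k. (x + (real r - (real k - 1) / 2))\<^sup>2) =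
        real k * x\<^sup>2 + (\<Sum>r<k. (real r - (real k - 1) / 2)\<^sup>2) + 2 * x * (\<Sum>r<k. real r - (real k - 1) / 2)"
      unfolding power2_sum sum.distrib sum_distrib_left by simp
    then show ?thesis by (simp add: sum_centered sum_centered_square)
  qed
  then have "(\<Sum>c\<in>words (Suc n) k. (centered_cost (Suc n) k c)\<^sup>2) =
      real k * (\<Sum>c\<in>words n k. (centered_cost n k c)\<^sup>2) + real k ^ n * (real k * (((real k)\<^sup>2 - 1) / 12))"
    using sum_centered_cost_Suc[where g = "\<lambda>x. x\<^sup>2"]
    by (simp add: sum.distrib sum_distrib_left card_words)
  moreover have "real k * (real k ^ n * (real n * V)) + real k ^ n * (real k * V) =
      real k ^ Suc n * (real (Suc n) * V)" for V
    by (simp add: algebra_simps)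
  ultimately show ?case unfolding Suc.IH by simp
qed (simp add: words_0 centered_cost_0)

text \<open>
  Up to the factor \<open>k^n\<close>, this is the characteristic function of a sum of \<open>n\<close> independent uniform
  variables on \<open>{..<k}\<close>, shifted by its mean.
\<close>

lemma sum_iexp_centered_cost:
  "(\<Sum>c\<in>words n k. iexp (\<theta> * centered_cost n k c)) = (\<Sum>r<k. iexp (\<theta> * (real r - (real k - 1) / 2))) ^ n"
proof (induction n)
  case (Suc n)
  have "(\<Sum>c\<in>words (Suc n) k. iexp (\<theta> * centered_cost (Suc n) k c)) =
      (\<Sum>c\<in>words n k. \<Sum>r<k. iexp (\<theta> * (centered_cost n k c + (real r - (real k - 1) / 2))))"
    by (rule sum_centered_cost_Suc)
  also have "\<dots> = (\<Sum>c\<in>words n k. \<Sum>r<k. iexp (\<theta> * centered_cost n k c) * iexp (\<theta> * (real r - (real k - 1) / 2)))"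
    by (intro sum.cong refl) (simp only: distrib_left of_real_add exp_add)
  also have "\<dots> = (\<Sum>c\<in>words n k. iexp (\<theta> * centered_cost n k c)) * (\<Sum>r<k. iexp (\<theta> * (real r - (real k - 1) / 2)))"
    by (simp only: sum_product)
  finally show ?case unfolding Suc.IH by simp
qed (simp add: words_0 centered_cost_0)

lemma abs_centered_cost_le:
  assumes "1 \<le> k"
  shows "\<bar>centered_cost n k c\<bar> \<le> real n * real k"
proof -
  have "mtf_rank k c j \<le> k" for j
    unfolding mtf_rank_def by (rule order.trans[OF card_mono[of "{..<k}"]]) auto
  then have "mtf_cost k n c \<le> (\<Sum>j\<in>{1..n}. k)"
    unfolding mtf_cost_def by (intro sum_mono)
  then have "real (mtf_cost k n c) \<le> real (n * k)"
    unfolding of_nat_le_iff by simp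
  moreover have "real n * ((real k - 1) / 2) \<le> real n * real k"
    by (rule mult_left_mono) (use assms in auto)
  moreover have "0 \<le> real n * ((real k - 1) / 2)" using assms by simp
  ultimately show ?thesis
    by (simp add: centered_cost_def abs_le_iff)
qed

lemma expectation_words_centered_cost:
  assumes "1 \<le> k"
  shows "measure_pmf.expectation (pmf_of_set (words n k)) (centered_cost n k) = 0"
    and "measure_pmf.expectation (pmf_of_set (words n k)) (\<lambda>c. (centered_cost n k c)\<^sup>2)
           = real n * (((real k)\<^sup>2 - 1) / 12)"
    and "measure_pmf.expectation (pmf_of_set (words n k)) (\<lambda>c. iexp (\<theta> * centered_cost n k c))
           = ((\<Sum>r<k. iexp (\<theta> * (real r - (real k - 1) / 2))) / of_nat k) ^ n"
proof -
  have "card (words n k) > 0" using assms by (simp add: card_words)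
  then have ne: "words n k \<noteq> {}" by force
  note E = expectation_pmf_of_set[OF finite_words ne] card_words
  show "measure_pmf.expectation (pmf_of_set (words n k)) (centered_cost n k) = 0"
    by (simp add: E sum_centered_cost)
  show "measure_pmf.expectation (pmf_of_set (words n k)) (\<lambda>c. (centered_cost n k c)\<^sup>2)
           = real n * (((real k)\<^sup>2 - 1) / 12)"
    using assms by (simp add: E sum_centered_cost_square)
  show "measure_pmf.expectation (pmf_of_set (words n k)) (\<lambda>c. iexp (\<theta> * centered_cost n k c))
           = ((\<Sum>r<k. iexp (\<theta> * (real r - (real k - 1) / 2))) / of_nat k) ^ n"
    unfolding E sum_iexp_centered_cost by (simp add: scaleR_conv_of_real power_divide)
qed

section \<open>The variance of the number of crossings\<close>

text \<open>
  The explicit form of ``\<open>n\<close> is large and \<open>k\<close> is small compared to \<open>sqrt n\<close>'' that the estimates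
  need. Together with \<open>k \<le> sqrt n\<close>, the last condition, true for all large \<open>n\<close>, bounds the probability
  of a word that is not surjective by \<open>k / n^2\<close>.
\<close>

definition few_blocks :: "nat \<Rightarrow> nat \<Rightarrow> bool" where
  "few_blocks n k \<longleftrightarrow> 1 \<le> k \<and> real k \<le> sqrt (real n) \<and> (real n)\<^sup>2 * exp (- sqrt (real n)) \<le> 1"

context
  fixes n k :: nat
  assumes few: "few_blocks n k"
begin

lemma few_blocks_simps:
  "1 \<le> k" "1 \<le> real k" "real k \<le> sqrt (real n)" "1 \<le> n" "k \<le> n" "real k * real k \<le> real n"
proof -
  show "1 \<le> k" "1 \<le> real k" and le: "real k \<le> sqrt (real n)" using few by (auto simp: few_blocks_def)
  then have "real k * real k \<le> sqrt (real n) * sqrt (real n)"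
    by (intro mult_mono) auto
  then show sq: "real k * real k \<le> real n" by simp
  have "1 * real k \<le> real k * real k" using \<open>1 \<le> real k\<close> by (intro mult_right_mono) auto
  then show "k \<le> n" using sq by simp
  then show "1 \<le> n" using \<open>1 \<le> k\<close> by simp
qed

lemma few_blocks_exp:
  "real k * exp (- (real n / real k)) \<le> real k / (real n)\<^sup>2"
proof -
  have "sqrt (real n) * real k \<le> sqrt (real n) * sqrt (real n)"
    using few_blocks_simps by (intro mult_left_mono) auto
  then have "sqrt (real n) \<le> real n / real k"
    using few_blocks_simps by (simp add: pos_le_divide_eq)
  then have "exp (- (real n / real k)) \<le> exp (- sqrt (real n))" by simp
  also have "\<dots> \<le> 1 / (real n)\<^sup>2"
    using few few_blocks_simps(4) by (simp add: few_blocks_def field_simps)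
  finally show ?thesis
    using mult_left_mono[of "exp (- (real n / real k))" "1 / (real n)\<^sup>2" "real k"] by simp
qed

abbreviation "random_surj_word \<equiv> pmf_of_set (surj_words n k)"
abbreviation "word_crossings \<equiv> \<lambda>c. crossings_rv (color_classes n k c)"
abbreviation "mean_cost \<equiv> real n * ((real k - 1) / 2)"

lemma set_pmf_random_surj_word: "set_pmf random_surj_word = surj_words n k"
  using finite_surj_words surj_words_nonempty few_blocks_simps by (simp add: set_pmf_of_set)

lemma integrable_random_surj_word:
  fixes f :: "(nat \<Rightarrow> nat) \<Rightarrow> 'b::{banach, second_countable_topology}"
  shows "integrable (measure_pmf random_surj_word) f"
  by (rule integrable_measure_pmf_finite) (simp add: set_pmf_random_surj_word finite_surj_words)

lemma norm_expectation_surj_le: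
  fixes f :: "(nat \<Rightarrow> nat) \<Rightarrow> 'b::{banach, second_countable_topology}"
  assumes "\<And>c. c \<in> surj_words n k \<Longrightarrow> norm (f c) \<le> g c"
  shows "norm (measure_pmf.expectation random_surj_word f) \<le> measure_pmf.expectation random_surj_word g"
proof -
  have "norm (measure_pmf.expectation random_surj_word f) \<le> measure_pmf.expectation random_surj_word (\<lambda>c. norm (f c))"
    by (rule integral_norm_bound)
  also have "\<dots> \<le> measure_pmf.expectation random_surj_word g"
    by (rule integral_mono_AE[OF integrable_random_surj_word integrable_random_surj_word])
       (simp add: AE_measure_pmf_iff set_pmf_random_surj_word assms)
  finally show ?thesis .
qed

lemma crossings_near_cost:
  assumes "c \<in> surj_words n k"
  shows "\<bar>word_crossings c - mean_cost - centered_cost n k c\<bar> \<le> 3 * (real k)\<^sup>2"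
proof -
  have "c \<in> {1..n} \<rightarrow> {..<k}"
    using assms by (auto simp: surj_words_def words_def)
  from crossings_mtf_cost[OF this] show ?thesis
    by (simp add: centered_cost_def)
qed

text \<open>
  The true value is exponentially small. The bound is of the same order as the distance between cost
  and crossings, so nothing is gained by a better one.
\<close>

lemma expectation_surj_centered_cost: "\<bar>measure_pmf.expectation random_surj_word (centered_cost n k)\<bar> \<le> 2 * (real k)\<^sup>2"
proof -
  have "\<bar>measure_pmf.expectation random_surj_word (centered_cost n k)\<bar> \<le> 2 * (real n * real k) * (real k * exp (- (real n / real k)))"
    using expectation_surj_words_close[of k n "centered_cost n k" "real n * real k"] few_blocks_simps(1,5)
      abs_centered_cost_le expectation_words_centered_cost(1)[of k n] by simp
  also have "\<dots> \<le> 2 * (real n * real k) * (real k / (real n)\<^sup>2)"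
    using few_blocks_exp by (intro mult_left_mono) auto
  also have "\<dots> = 2 * (real k)\<^sup>2 * (1 / real n)"
    using few_blocks_simps(4) by (simp add: power2_eq_square)
  also have "\<dots> \<le> 2 * (real k)\<^sup>2 * 1"
    using few_blocks_simps(4) by (intro mult_left_mono) auto
  finally show ?thesis by simp
qed

lemma expectation_surj_centered_cost_square:
  "\<bar>measure_pmf.expectation random_surj_word (\<lambda>c. (centered_cost n k c)\<^sup>2) - real n * (((real k)\<^sup>2 - 1) / 12)\<bar> \<le> 2 * real k ^ 3"
proof -
  have "(centered_cost n k c)\<^sup>2 \<le> (real n * real k)\<^sup>2" for c
    using abs_centered_cost_le[OF few_blocks_simps(1), of n c]
    by (simp add: abs_le_square_iff[symmetric])
  then have "\<bar>measure_pmf.expectation random_surj_word (\<lambda>c. (centered_cost n k c)\<^sup>2) - real n * (((real k)\<^sup>2 - 1) / 12)\<bar>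
      \<le> 2 * (real n * real k)\<^sup>2 * (real k * exp (- (real n / real k)))"
    using expectation_surj_words_close[of k n "\<lambda>c. (centered_cost n k c)\<^sup>2" "(real n * real k)\<^sup>2"] few_blocks_simps(1,5)
      expectation_words_centered_cost(2)[of k n] by simp
  also have "\<dots> \<le> 2 * (real n * real k)\<^sup>2 * (real k / (real n)\<^sup>2)"
    using few_blocks_exp by (intro mult_left_mono) auto
  also have "\<dots> = 2 * real k ^ 3"
    using few_blocks_simps(4) by (simp add: power2_eq_square power3_eq_cube)
  finally show ?thesis .
qed

lemma crossings_mean_eq: "crossings_mean n k = measure_pmf.expectation random_surj_word word_crossings"
  using partition_pmf_eq_map_surj_words few_blocks_simps by (simp add: crossings_mean_def)

lemma crossings_variance_eq:
  "crossings_variance n k = measure_pmf.expectation random_surj_word (\<lambda>c. (word_crossings c - mean_cost)\<^sup>2)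
     - (measure_pmf.expectation random_surj_word (\<lambda>c. word_crossings c - mean_cost))\<^sup>2"
proof -
  have shift: "measure_pmf.expectation random_surj_word (\<lambda>c. word_crossings c - mean_cost) = crossings_mean n k - mean_cost"
    by (simp add: crossings_mean_eq integrable_random_surj_word)
  have "crossings_variance n k = measure_pmf.variance random_surj_word (\<lambda>c. word_crossings c - mean_cost)"
    unfolding shift
    using partition_pmf_eq_map_surj_words few_blocks_simps
    by (simp add: crossings_variance_def crossings_mean_def)
  also have "\<dots> = measure_pmf.expectation random_surj_word (\<lambda>c. (word_crossings c - mean_cost)\<^sup>2)
     - (measure_pmf.expectation random_surj_word (\<lambda>c. word_crossings c - mean_cost))\<^sup>2"
    by (rule measure_pmf.variance_eq[OF integrable_random_surj_word integrable_random_surj_word])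
  finally show ?thesis .
qed

lemma expectation_surj_shifted_crossings: "\<bar>measure_pmf.expectation random_surj_word (\<lambda>c. word_crossings c - mean_cost)\<bar> \<le> 5 * (real k)\<^sup>2"
proof -
  have "\<bar>measure_pmf.expectation random_surj_word (\<lambda>c. word_crossings c - mean_cost) - measure_pmf.expectation random_surj_word (centered_cost n k)\<bar> \<le> 3 * (real k)\<^sup>2"
    using norm_expectation_surj_le[of "\<lambda>c. word_crossings c - mean_cost - centered_cost n k c" "\<lambda>_. 3 * (real k)\<^sup>2"]
      crossings_near_cost by (simp add: integrable_random_surj_word)
  then show ?thesis using expectation_surj_centered_cost by linarith
qed

lemma crossings_mean_near: "\<bar>crossings_mean n k - mean_cost\<bar> \<le> 5 * (real k)\<^sup>2"
  using expectation_surj_shifted_crossings by (simp add: crossings_mean_eq integrable_random_surj_word)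

text \<open>
  On surjective words, the number of crossings minus the mean cost is the centered cost plus an error
  \<open>d\<close> with \<open>\<bar>d\<bar> \<le> 3 * k^2\<close>. The dominant contribution of \<open>d\<close> to the second moment is the
  cross term, of order \<open>k^2\<close> times the standard deviation \<open>k * sqrt n\<close>.
\<close>

lemma crossings_variance_near:
  "\<bar>crossings_variance n k - ((real k)\<^sup>2 - 1) / 12 * real n\<bar> \<le> 48 * (real k ^ 3 * sqrt (real n))"
proof -
  define s where "s = sqrt (real n)"
  define \<kappa> where "\<kappa> = real k"
  have k: "1 \<le> \<kappa>" "\<kappa> \<le> s" and s: "0 < s" "s * s = real n" "1 \<le> s"
    using few_blocks_simps by (auto simp: s_def \<kappa>_def)
  have k4: "\<kappa>\<^sup>2 * \<kappa>\<^sup>2 \<le> \<kappa> ^ 3 * s"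
    using mult_left_mono[OF k(2), of "\<kappa> ^ 3"] k by (simp add: power2_eq_square power3_eq_cube mult_ac)
  have k3: "\<kappa> ^ 3 \<le> \<kappa> ^ 3 * s"
    using mult_left_mono[OF s(3), of "\<kappa> ^ 3"] k by simp
  define EZ where "EZ = measure_pmf.expectation random_surj_word (\<lambda>c. (centered_cost n k c)\<^sup>2)"
  define V where "V = (\<kappa>\<^sup>2 - 1) / 12 * real n"
  have EZ: "\<bar>EZ - V\<bar> \<le> 2 * \<kappa> ^ 3"
    using expectation_surj_centered_cost_square by (simp add: EZ_def V_def \<kappa>_def mult.commute)
  have EZ_le: "EZ \<le> 3 * (\<kappa> * s)\<^sup>2"
  proof -
    have "(\<kappa>\<^sup>2 - 1) / 12 \<le> \<kappa>\<^sup>2 / 1" by (rule frac_le) auto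
    then have "V \<le> \<kappa>\<^sup>2 * real n" unfolding V_def by (intro mult_right_mono) simp_all
    moreover have "\<kappa>\<^sup>2 * \<kappa> \<le> \<kappa>\<^sup>2 * (s * s)"
      using k s mult_mono[of \<kappa> s 1 s] by (intro mult_left_mono) auto
    ultimately show ?thesis using EZ s
      by (simp add: power2_eq_square power3_eq_cube mult_ac)
  qed
  have pt: "\<bar>(word_crossings c - mean_cost)\<^sup>2 - (centered_cost n k c)\<^sup>2\<bar> \<le> 3 * \<kappa>\<^sup>2 * ((centered_cost n k c)\<^sup>2 / (\<kappa> * s) + \<kappa> * s) + 9 * (\<kappa>\<^sup>2 * \<kappa>\<^sup>2)"
    if "c \<in> surj_words n k" for c
  proof -
    define d where "d = word_crossings c - mean_cost - centered_cost n k c"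
    have d: "\<bar>d\<bar> \<le> 3 * \<kappa>\<^sup>2"
      using crossings_near_cost[OF that] by (simp add: d_def \<kappa>_def)
    \<comment> \<open>Bounding the absolute value by the square loses only a constant factor when the weight \<open>\<kappa> * s\<close> has the order of the standard deviation.\<close>
    have "0 \<le> (\<bar>centered_cost n k c\<bar> - \<kappa> * s)\<^sup>2" by simp
    then have "2 * \<bar>centered_cost n k c\<bar> * (\<kappa> * s) \<le> (centered_cost n k c)\<^sup>2 + (\<kappa> * s)\<^sup>2"
      by (simp add: power2_diff)
    then have Zle: "2 * \<bar>centered_cost n k c\<bar> \<le> (centered_cost n k c)\<^sup>2 / (\<kappa> * s) + \<kappa> * s"
      using k s by (simp add: field_simps power2_eq_square)
    have "y\<^sup>2 - z\<^sup>2 = (y - z) * (2 * z) + (y - z) * (y - z)" for y z :: real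
      by algebra
    then have "(word_crossings c - mean_cost)\<^sup>2 - (centered_cost n k c)\<^sup>2 = d * (2 * centered_cost n k c) + d * d"
      unfolding d_def .
    also have "\<bar>\<dots>\<bar> \<le> \<bar>d\<bar> * (2 * \<bar>centered_cost n k c\<bar>) + \<bar>d\<bar> * \<bar>d\<bar>"
      by (rule order.trans[OF abs_triangle_ineq]) (simp add: abs_mult)
    also have "\<dots> \<le> 3 * \<kappa>\<^sup>2 * ((centered_cost n k c)\<^sup>2 / (\<kappa> * s) + \<kappa> * s) + (3 * \<kappa>\<^sup>2) * (3 * \<kappa>\<^sup>2)"
      using d Zle by (intro add_mono mult_mono) auto
    finally show ?thesis by simp
  qed
  have "\<bar>measure_pmf.expectation random_surj_word (\<lambda>c. (word_crossings c - mean_cost)\<^sup>2) - EZ\<bar>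
      \<le> measure_pmf.expectation random_surj_word (\<lambda>c. 3 * \<kappa>\<^sup>2 * ((centered_cost n k c)\<^sup>2 / (\<kappa> * s) + \<kappa> * s) + 9 * (\<kappa>\<^sup>2 * \<kappa>\<^sup>2))"
    using norm_expectation_surj_le[of "\<lambda>c. (word_crossings c - mean_cost)\<^sup>2 - (centered_cost n k c)\<^sup>2", OF pt[folded real_norm_def]]
    by (simp add: EZ_def integrable_random_surj_word)
  also have "\<dots> = 3 * \<kappa>\<^sup>2 * (EZ / (\<kappa> * s) + \<kappa> * s) + 9 * (\<kappa>\<^sup>2 * \<kappa>\<^sup>2)"
    by (simp add: EZ_def integrable_random_surj_word)
  also have "\<dots> \<le> 3 * \<kappa>\<^sup>2 * (3 * (\<kappa> * s)\<^sup>2 / (\<kappa> * s) + \<kappa> * s) + 9 * (\<kappa> ^ 3 * s)"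
    using EZ_le k s k4 by (intro add_mono mult_left_mono divide_right_mono) auto
  also have "\<dots> = 21 * (\<kappa> ^ 3 * s)"
    using k s by (simp add: power2_eq_square power3_eq_cube)
  finally have 1: "\<bar>measure_pmf.expectation random_surj_word (\<lambda>c. (word_crossings c - mean_cost)\<^sup>2) - EZ\<bar> \<le> 21 * (\<kappa> ^ 3 * s)" .
  have "(measure_pmf.expectation random_surj_word (\<lambda>c. word_crossings c - mean_cost))\<^sup>2 \<le> (5 * \<kappa>\<^sup>2)\<^sup>2"
    using power_mono[OF expectation_surj_shifted_crossings abs_ge_zero, of 2] by (simp only: \<kappa>_def power2_abs)
  also have "\<dots> = 25 * (\<kappa>\<^sup>2 * \<kappa>\<^sup>2)"
    by (simp add: power2_eq_square)
  finally have 2: "(measure_pmf.expectation random_surj_word (\<lambda>c. word_crossings c - mean_cost))\<^sup>2 \<le> 25 * (\<kappa> ^ 3 * s)"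
    using k4 by linarith
  have "0 \<le> (measure_pmf.expectation random_surj_word (\<lambda>c. word_crossings c - mean_cost))\<^sup>2" by simp
  then have "\<bar>crossings_variance n k - V\<bar> \<le> 48 * (\<kappa> ^ 3 * s)"
    using 1 2 EZ k3 unfolding crossings_variance_eq abs_le_iff by linarith
  then show ?thesis by (simp only: V_def \<kappa>_def s_def)
qed

end

section \<open>Characteristic functions\<close>

lemma norm_iexp_diff_le: "norm (iexp a - iexp b) \<le> \<bar>a - b\<bar>"
proof -
  have "iexp a - iexp b = iexp b * (iexp (a - b) - 1)"
    by (simp add: algebra_simps flip: exp_add)
  then have "norm (iexp a - iexp b) = norm (iexp (a - b) - 1)"
    by (simp add: norm_mult)
  also have "\<dots> \<le> \<bar>a - b\<bar>"
    using iexp_approx1[of "a - b" 0] by simp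
  finally show ?thesis .
qed

lemma iexp_quadratic_approx:
  "norm (iexp x - (1 + \<i> * of_real x - of_real (x\<^sup>2 / 2))) \<le> \<bar>x\<bar> ^ 3 / 6"
proof -
  have "(\<Sum>j\<le>2. (\<i> * complex_of_real x) ^ j / fact j) = 1 + \<i> * of_real x + (\<i> * of_real x)\<^sup>2 / 2"
    by (simp add: numeral_2_eq_2)
  also have "(\<i> * complex_of_real x)\<^sup>2 = - of_real (x\<^sup>2)"
    by (simp add: power_mult_distrib)
  finally have "(\<Sum>j\<le>2. (\<i> * complex_of_real x) ^ j / fact j) = 1 + \<i> * of_real x - of_real (x\<^sup>2 / 2)"
    by simp
  moreover have "fact (Suc 2) = (6 :: real)" "Suc 2 = 3" by (simp_all add: numeral_2_eq_2)
  ultimately show ?thesis using iexp_approx1[of x 2] by simp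
qed

lemma uniform_char_approx:
  assumes "1 \<le> k"
  shows "norm ((\<Sum>r<k. iexp (\<theta> * (real r - (real k - 1) / 2))) / of_nat k
           - of_real (1 - \<theta>\<^sup>2 * (((real k)\<^sup>2 - 1) / 12) / 2)) \<le> \<bar>\<theta>\<bar> ^ 3 * real k ^ 3 / 6"
proof -
  let ?x = "\<lambda>r. real r - (real k - 1) / 2"
  let ?P = "\<lambda>r. 1 + \<i> * of_real (\<theta> * ?x r) - of_real ((\<theta> * ?x r)\<^sup>2 / 2)"
  have step: "norm (iexp (\<theta> * ?x r) - ?P r) \<le> \<bar>\<theta>\<bar> ^ 3 * real k ^ 3 / 6" if "r < k" for r
  proof -
    have "norm (iexp (\<theta> * ?x r) - ?P r) \<le> \<bar>\<theta> * ?x r\<bar> ^ 3 / 6"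
      by (rule iexp_quadratic_approx)
    also have "\<bar>\<theta> * ?x r\<bar> ^ 3 \<le> (\<bar>\<theta>\<bar> * real k) ^ 3"
      unfolding abs_mult using that assms by (intro power_mono mult_left_mono) (auto simp: abs_le_iff field_simps)
    finally show ?thesis by (simp add: power_mult_distrib)
  qed
  have "(\<Sum>r<k. \<i> * complex_of_real (\<theta> * ?x r)) = \<i> * of_real (\<theta> * (\<Sum>r<k. ?x r))"
    by (simp only: sum_distrib_left of_real_sum)
  moreover have "(\<Sum>r<k. complex_of_real ((\<theta> * ?x r)\<^sup>2 / 2)) = of_real (\<theta>\<^sup>2 / 2 * (\<Sum>r<k. (?x r)\<^sup>2))"
    by (simp only: sum_distrib_left of_real_sum power_mult_distrib times_divide_eq_left)
  ultimately have "(\<Sum>r<k. ?P r) = of_nat k + \<i> * of_real (\<theta> * (\<Sum>r<k. ?x r)) - of_real (\<theta>\<^sup>2 / 2 * (\<Sum>r<k. (?x r)\<^sup>2))"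
    by (simp only: sum_subtractf sum.distrib sum_constant card_lessThan mult_1_right)
  also have "\<dots> = of_nat k * of_real (1 - \<theta>\<^sup>2 * (((real k)\<^sup>2 - 1) / 12) / 2)"
  proof -
    have "of_nat k + \<i> * of_real (\<theta> * 0) - of_real (\<theta>\<^sup>2 / 2 * (real k * v)) =
        of_nat k * complex_of_real (1 - \<theta>\<^sup>2 * v / 2)" for v
      by (simp add: algebra_simps)
    then show ?thesis unfolding sum_centered sum_centered_square .
  qed
  finally have P: "(\<Sum>r<k. ?P r) / of_nat k = of_real (1 - \<theta>\<^sup>2 * (((real k)\<^sup>2 - 1) / 12) / 2)"
    using assms by simp
  have "norm ((\<Sum>r<k. iexp (\<theta> * ?x r)) / of_nat k - (\<Sum>r<k. ?P r) / of_nat k)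
      = norm (\<Sum>r<k. iexp (\<theta> * ?x r) - ?P r) / real k"
    by (simp add: sum_subtractf norm_divide flip: diff_divide_distrib)
  also have "\<dots> \<le> (real (card {..<k}) * (\<bar>\<theta>\<bar> ^ 3 * real k ^ 3 / 6)) / real k"
    using step by (intro divide_right_mono sum_norm_bound) auto
  also have "\<dots> = \<bar>\<theta>\<bar> ^ 3 * real k ^ 3 / 6" using assms by simp
  finally show ?thesis unfolding P .
qed

lemma exp_minus_quadratic:
  assumes "0 \<le> (u::real)"
  shows "\<bar>exp (- u) - (1 - u)\<bar> \<le> u\<^sup>2 / 2"
proof -
  have "1 - u \<le> exp (- u)" using exp_ge_add_one_self[of "- u"] by simp
  moreover have "exp (- u) \<le> 1 - u + u\<^sup>2 / 2"
  proof -
    have "1 \<le> (1 - u + u\<^sup>2 / 2) * (1 + u + u\<^sup>2 / 2)"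
      using assms by (simp add: field_simps power2_eq_square)
    also have "\<dots> \<le> (1 - u + u\<^sup>2 / 2) * exp u"
    proof (rule mult_left_mono)
      show "1 + u + u\<^sup>2 / 2 \<le> exp u" using exp_lower_Taylor_quadratic[OF assms] .
      show "0 \<le> 1 - u + u\<^sup>2 / 2"
        using zero_le_power2[of "1 - u"] unfolding power2_diff by simp
    qed
    finally show ?thesis by (simp add: exp_minus field_simps)
  qed
  ultimately show ?thesis by simp
qed

text \<open>
  For \<open>k \<ge> 2\<close> we have \<open>(k^2 - 1) / 12 \<ge> k^2 / 16\<close>, so the standard deviation is at least a quarter
  of \<open>k * sqrt n\<close>. The case \<open>k = 1\<close> has to be excluded because there the variance vanishes.
\<close>

lemma std_dev_lower:
  assumes "2 \<le> k" "1 \<le> n"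
  shows "real k * sqrt (real n) / 4 \<le> sqrt (real n * (((real k)\<^sup>2 - 1) / 12))"
proof (rule real_le_rsqrt)
  have "4 \<le> (real k)\<^sup>2" using assms power_mono[of 2 "real k" 2] by simp
  then have "(real k)\<^sup>2 / 16 \<le> ((real k)\<^sup>2 - 1) / 12" by simp
  then have "real n * ((real k)\<^sup>2 / 16) \<le> real n * (((real k)\<^sup>2 - 1) / 12)"
    by (intro mult_left_mono) auto
  then show "(real k * sqrt (real n) / 4)\<^sup>2 \<le> real n * (((real k)\<^sup>2 - 1) / 12)"
    by (simp add: power_mult_distrib power_divide mult_ac)
qed

text \<open>
  A uniform variable on \<open>{..<k}\<close>, centered and divided by its standard deviation, is bounded independently of \<open>k\<close>.
  Hence the Taylor remainder of the characteristic function is \<open>O(n powr (- 3 / 2))\<close> uniformly in \<open>k\<close>,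
  and the \<open>n\<close>-th power multiplies the errors by at most \<open>n\<close>.
\<close>

lemma uniform_sum_char_approx:
  assumes k: "2 \<le> k" and n: "1 \<le> n"
  defines "\<sigma> \<equiv> sqrt (real n * (((real k)\<^sup>2 - 1) / 12))"
  shows "norm (((\<Sum>r<k. iexp (\<tau> / \<sigma> * (real r - (real k - 1) / 2))) / of_nat k) ^ n
           - of_real (exp (- (\<tau>\<^sup>2) / 2))) \<le> 11 * \<bar>\<tau>\<bar> ^ 3 / sqrt (real n) + \<tau> ^ 4 / (8 * real n)"
proof -
  let ?v = "((real k)\<^sup>2 - 1) / 12"
  define \<phi> where "\<phi> = (\<Sum>r<k. iexp (\<tau> / \<sigma> * (real r - (real k - 1) / 2))) / of_nat k"
  define u where "u = \<tau>\<^sup>2 / (2 * real n)"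
  define s where "s = sqrt (real n)"
  have s: "0 < s" "s * s = real n" using n by (auto simp: s_def)
  have low: "real k * s / 4 \<le> \<sigma>" using std_dev_lower[OF k n] by (simp add: \<sigma>_def s_def)
  have ks: "0 < real k * s / 4" using k s by simp
  then have \<sigma>: "0 < \<sigma>" using low by linarith
  have v: "0 < ?v"
    using \<sigma> n by (simp add: \<sigma>_def zero_less_mult_iff)
  then have \<sigma>2: "\<sigma>\<^sup>2 = real n * ?v" by (simp add: \<sigma>_def)
  have u: "(\<tau> / \<sigma>)\<^sup>2 * ?v / 2 = u"
    unfolding power_divide \<sigma>2 using v n by (simp add: u_def)
  have u0: "0 \<le> u" by (simp add: u_def)
  have "\<bar>\<tau> / \<sigma>\<bar> * real k \<le> 4 * \<bar>\<tau>\<bar> / s"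
  proof -
    have "real k / \<sigma> \<le> real k / (real k * s / 4)"
      using low ks \<sigma> by (intro divide_left_mono) auto
    also have "\<dots> = 4 / s" using k by simp
    finally have "\<bar>\<tau>\<bar> * (real k / \<sigma>) \<le> \<bar>\<tau>\<bar> * (4 / s)" by (intro mult_left_mono) auto
    then show ?thesis using \<sigma> by (simp add: abs_divide mult_ac)
  qed
  then have "(\<bar>\<tau> / \<sigma>\<bar> * real k) ^ 3 \<le> (4 * \<bar>\<tau>\<bar> / s) ^ 3"
    by (intro power_mono) auto
  moreover have "(4 * \<bar>\<tau>\<bar> / s) ^ 3 = 64 * \<bar>\<tau>\<bar> ^ 3 / (s * real n)"
    unfolding s(2)[symmetric] by (simp add: power_divide power_mult_distrib power3_eq_cube mult_ac)
  ultimately have cube: "\<bar>\<tau> / \<sigma>\<bar> ^ 3 * real k ^ 3 \<le> 64 * \<bar>\<tau>\<bar> ^ 3 / (s * real n)"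
    by (simp only: power_mult_distrib)
  have d1: "norm (\<phi> - of_real (1 - u)) \<le> 64 * \<bar>\<tau>\<bar> ^ 3 / (s * real n) / 6"
  proof -
    have "1 \<le> k" using k by simp
    show ?thesis
      unfolding \<phi>_def
      by (rule order.trans[OF uniform_char_approx[OF \<open>1 \<le> k\<close>, of "\<tau> / \<sigma>", unfolded u] divide_right_mono[OF cube]]) simp
  qed
  have d2: "norm (of_real (1 - u) - of_real (exp (- u)) :: complex) \<le> u\<^sup>2 / 2"
    unfolding of_real_diff[symmetric] norm_of_real using exp_minus_quadratic[OF u0] by (simp add: abs_minus_commute)
  have "norm \<phi> \<le> 1"
  proof -
    have "norm (\<Sum>r<k. iexp (\<tau> / \<sigma> * (real r - (real k - 1) / 2))) \<le> real (card {..<k}) * 1"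
      by (rule sum_norm_bound) simp
    then show ?thesis using k by (simp add: \<phi>_def norm_divide)
  qed
  moreover have "norm (of_real (exp (- u)) :: complex) \<le> 1" using u0 by simp
  ultimately have "norm (\<phi> ^ n - of_real (exp (- u)) ^ n) \<le> real n * norm (\<phi> - of_real (exp (- u)))"
    by (rule norm_power_diff)
  also have "of_real (exp (- u)) ^ n = (of_real (exp (- (\<tau>\<^sup>2) / 2)) :: complex)"
    using n by (simp add: u_def exp_of_nat_mult[symmetric] flip: of_real_power)
  also have "real n * norm (\<phi> - of_real (exp (- u))) \<le> real n * (64 * \<bar>\<tau>\<bar> ^ 3 / (s * real n) / 6 + u\<^sup>2 / 2)"
    using norm_triangle_ineq[of "\<phi> - of_real (1 - u)" "of_real (1 - u) - of_real (exp (- u))"] d1 d2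
    by (intro mult_left_mono) auto
  also have "\<dots> = 64 / 6 * (\<bar>\<tau>\<bar> ^ 3 / s) + \<tau> ^ 4 / (8 * real n)"
    using n s by (simp add: u_def field_simps power2_eq_square power4_eq_xxxx)
  also have "\<dots> \<le> 11 * (\<bar>\<tau>\<bar> ^ 3 / s) + \<tau> ^ 4 / (8 * real n)"
    using s by (intro add_right_mono mult_right_mono) auto
  finally show ?thesis by (simp add: \<phi>_def s_def)
qed

text \<open>
  Normalising with the true variance instead of \<open>n * (k^2 - 1) / 12\<close> amounts to replacing the argument
  \<open>t\<close> by \<open>\<tau>\<close>. The errors come from replacing the crossings by the cost, from dropping
  the condition that the word is surjective, and from the Gaussian approximation.
\<close>

lemma crossings_char_approx:
  fixes t :: real
  assumes few: "few_blocks n k" and k: "2 \<le> k"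
  defines "\<tau> \<equiv> t * (sqrt (real n * (((real k)\<^sup>2 - 1) / 12)) / sqrt (crossings_variance n k))"
  shows "norm (char (distr (measure_pmf (partition_pmf n k)) borel
             (\<lambda>\<pi>. (crossings_rv \<pi> - crossings_mean n k) / sqrt (crossings_variance n k))) t
           - of_real (exp (- (\<tau>\<^sup>2) / 2)))
         \<le> (32 * \<bar>\<tau>\<bar> + 2) * (real k / sqrt (real n)) + 11 * \<bar>\<tau>\<bar> ^ 3 / sqrt (real n) + \<tau> ^ 4 / (8 * real n)"
proof -
  note few_simps = few_blocks_simps[OF few]
  define \<sigma> where "\<sigma> = sqrt (real n * (((real k)\<^sup>2 - 1) / 12))"
  define \<theta> where "\<theta> = t / sqrt (crossings_variance n k)"
  let ?q = "pmf_of_set (surj_words n k)"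
  let ?Y = "\<lambda>c. crossings_rv (color_classes n k c)"
  define s where "s = sqrt (real n)"
  have s: "1 \<le> s" "s * s = real n" using few_simps by (auto simp: s_def)
  have low: "real k * s / 4 \<le> \<sigma>" using std_dev_lower[OF k few_simps(4)] by (simp add: \<sigma>_def s_def)
  have ks: "0 < real k * s / 4" using k s by simp
  then have \<sigma>: "0 < \<sigma>" using low by linarith
  have \<theta>: "\<theta> = \<tau> / \<sigma>" unfolding \<theta>_def \<tau>_def \<sigma>_def[symmetric] using \<sigma> by simp
  have char: "char (distr (measure_pmf (partition_pmf n k)) borel
             (\<lambda>\<pi>. (crossings_rv \<pi> - crossings_mean n k) / sqrt (crossings_variance n k))) t
      = measure_pmf.expectation ?q (\<lambda>c. iexp (\<theta> * (?Y c - crossings_mean n k)))"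
    using partition_pmf_eq_map_surj_words[OF few_simps(1,5)]
    by (simp add: char_def integral_distr \<theta>_def)
  \<comment> \<open>The deviation \<open>8 * k^2\<close> consists of \<open>3 * k^2\<close> for the crossings of a single word and \<open>5 * k^2\<close> for their mean.\<close>
  have d1: "norm (measure_pmf.expectation ?q (\<lambda>c. iexp (\<theta> * (?Y c - crossings_mean n k)))
        - measure_pmf.expectation ?q (\<lambda>c. iexp (\<theta> * centered_cost n k c))) \<le> 32 * \<bar>\<tau>\<bar> * (real k / s)"
  proof -
    have pt: "norm (iexp (\<theta> * (?Y c - crossings_mean n k)) - iexp (\<theta> * centered_cost n k c))
        \<le> \<bar>\<theta>\<bar> * (8 * (real k)\<^sup>2)" if "c \<in> surj_words n k" for c
    proof -
      have "\<bar>?Y c - crossings_mean n k - centered_cost n k c\<bar> \<le> 8 * (real k)\<^sup>2"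
        using crossings_near_cost[OF few that] crossings_mean_near[OF few] by linarith
      then have "\<bar>\<theta>\<bar> * \<bar>?Y c - crossings_mean n k - centered_cost n k c\<bar> \<le> \<bar>\<theta>\<bar> * (8 * (real k)\<^sup>2)"
        by (intro mult_left_mono) auto
      moreover have "\<theta> * (?Y c - crossings_mean n k) - \<theta> * centered_cost n k c =
          \<theta> * (?Y c - crossings_mean n k - centered_cost n k c)" by (simp add: algebra_simps)
      ultimately show ?thesis
        using norm_iexp_diff_le[of "\<theta> * (?Y c - crossings_mean n k)" "\<theta> * centered_cost n k c"]
        by (simp only: abs_mult)
    qed
    have "norm (measure_pmf.expectation ?q (\<lambda>c. iexp (\<theta> * (?Y c - crossings_mean n k)))
        - measure_pmf.expectation ?q (\<lambda>c. iexp (\<theta> * centered_cost n k c))) \<le> \<bar>\<theta>\<bar> * (8 * (real k)\<^sup>2)"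
      using norm_expectation_surj_le[OF few pt] 
      by (simp add: Bochner_Integration.integral_diff[OF integrable_random_surj_word[OF few] integrable_random_surj_word[OF few]])
    also have "\<dots> = 8 * \<bar>\<tau>\<bar> * (real k * (real k / \<sigma>))"
      using \<sigma> by (simp add: \<theta> abs_divide power2_eq_square)
    also have "\<dots> \<le> 8 * \<bar>\<tau>\<bar> * (real k * (real k / (real k * s / 4)))"
      using low ks \<sigma> by (intro mult_left_mono divide_left_mono) auto
    also have "\<dots> = 32 * \<bar>\<tau>\<bar> * (real k / s)" using k by simp
    finally show ?thesis .
  qed
  have d2: "norm (measure_pmf.expectation ?q (\<lambda>c. iexp (\<theta> * centered_cost n k c))
      - measure_pmf.expectation (pmf_of_set (words n k)) (\<lambda>c. iexp (\<theta> * centered_cost n k c))) \<le> 2 * (real k / s)"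
  proof -
    have "s * 1 \<le> s * s"
      using s(1) by (intro mult_left_mono) auto
    also have "s * s = real n * 1" using s by simp
    also have "\<dots> \<le> real n * real n"
      using few_simps(4) by (intro mult_left_mono) auto
    finally have "s \<le> (real n)\<^sup>2" by (simp add: power2_eq_square)
    then have "real k / (real n)\<^sup>2 \<le> real k / s"
      using s few_simps by (intro divide_left_mono) auto
    moreover have "norm (measure_pmf.expectation ?q (\<lambda>c. iexp (\<theta> * centered_cost n k c))
      - measure_pmf.expectation (pmf_of_set (words n k)) (\<lambda>c. iexp (\<theta> * centered_cost n k c)))
        \<le> 2 * 1 * (real k * exp (- (real n / real k)))"
      by (rule expectation_surj_words_close) (use few_simps in auto)
    ultimately show ?thesis using few_blocks_exp[OF few] by linarith
  qed
  have d3: "norm (measure_pmf.expectation (pmf_of_set (words n k)) (\<lambda>c. iexp (\<theta> * centered_cost n k c))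
      - of_real (exp (- (\<tau>\<^sup>2) / 2))) \<le> 11 * \<bar>\<tau>\<bar> ^ 3 / s + \<tau> ^ 4 / (8 * real n)"
    unfolding expectation_words_centered_cost(3)[OF few_simps(1)] \<theta> \<sigma>_def s_def
    by (rule uniform_sum_char_approx[OF k few_simps(4)])
  have "norm (x - w) \<le> norm (x - y) + norm (y - z) + norm (z - w)" for x y z w :: complex
    using norm_triangle_ineq[of "x - y" "y - z"] norm_triangle_ineq[of "x - z" "z - w"] by simp
  from order.trans[OF this add_mono[OF add_mono[OF d1 d2] d3]] show ?thesis
    unfolding char s_def[symmetric] by (simp only: distrib_right add.assoc)
qed

section \<open>The limit theorem\<close>

lemma eventually_few_blocks:
  fixes k :: "nat \<Rightarrow> nat"
  assumes "\<And>n. n \<ge> 1 \<Longrightarrow> 1 \<le> k n" "(\<lambda>n. real (k n)) \<in> o(\<lambda>n. sqrt (real n))"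
  shows "\<forall>\<^sub>F n in sequentially. few_blocks n (k n)"
proof -
  have "\<forall>\<^sub>F n in sequentially. norm (real (k n)) \<le> 1 * norm (sqrt (real n))"
    by (rule landau_o.smallD[OF assms(2)]) simp
  moreover have "\<forall>\<^sub>F n in sequentially. (real n)\<^sup>2 * exp (- sqrt (real n)) \<le> 1"
    by real_asymp
  ultimately show ?thesis
    using eventually_ge_at_top[of 1]
    by eventually_elim (use assms(1) in \<open>auto simp: few_blocks_def\<close>)
qed

lemma std_dev_ratio_tendsto:
  fixes k :: "nat \<Rightarrow> nat"
  assumes few: "\<forall>\<^sub>F n in sequentially. few_blocks n (k n)" and k: "\<forall>\<^sub>F n in sequentially. 2 \<le> k n"
    and lim: "(\<lambda>n. real (k n) / sqrt (real n)) \<longlonglongrightarrow> 0"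
  shows "(\<lambda>n. sqrt (real n * (((real (k n))\<^sup>2 - 1) / 12)) / sqrt (crossings_variance n (k n))) \<longlonglongrightarrow> 1"
proof -
  let ?V = "\<lambda>n. real n * (((real (k n))\<^sup>2 - 1) / 12)"
  have bound: "\<forall>\<^sub>F n in sequentially. norm (crossings_variance n (k n) / ?V n - 1) \<le> 768 * (real (k n) / sqrt (real n))"
    using few k
  proof eventually_elim
    case (elim n)
    let ?\<kappa> = "real (k n)" and ?s = "sqrt (real n)"
    have s: "0 < ?s" "?s * ?s = real n" using few_blocks_simps[OF elim(1)] by auto
    have \<kappa>: "2 \<le> ?\<kappa>" using elim by simp
    have "0 < ?\<kappa> * ?s / 4" using \<kappa> s by simp
    then have V: "(?\<kappa> * ?s / 4)\<^sup>2 \<le> ?V n" "0 < ?V n"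
      using std_dev_lower[OF elim(2) few_blocks_simps(4)[OF elim(1)]]
      by (smt (verit) real_sqrt_le_0_iff real_sqrt_pow2 power_mono)+
    have "norm (crossings_variance n (k n) / ?V n - 1) = \<bar>crossings_variance n (k n) - ?V n\<bar> / ?V n"
    proof -
      have "norm (a / v - 1) = \<bar>a - v\<bar> / v" if "0 < v" for a v :: real
      proof -
        have "a / v - 1 = (a - v) / v" using that by (simp add: diff_divide_distrib)
        then show ?thesis using that by (simp add: abs_divide)
      qed
      then show ?thesis using V(2) by blast
    qed
    also have "\<dots> \<le> 48 * (?\<kappa> ^ 3 * ?s) / ?V n"
      using crossings_variance_near[OF elim(1)] V(2) by (intro divide_right_mono) (auto simp: mult.commute)
    also have "\<dots> \<le> 48 * (?\<kappa> ^ 3 * ?s) / (?\<kappa> * ?s / 4)\<^sup>2"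
      using V \<kappa> s by (intro divide_left_mono) auto
    also have "\<dots> = 768 * (?\<kappa> / ?s)"
      using \<kappa> s(1) by (simp add: power2_eq_square power3_eq_cube field_simps del: real_sqrt_mult_self)
    finally show ?case .
  qed
  have "(\<lambda>n. 768 * (real (k n) / sqrt (real n))) \<longlonglongrightarrow> 0"
    using tendsto_mult_right_zero[OF lim] .
  then have "(\<lambda>n. crossings_variance n (k n) / ?V n - 1) \<longlonglongrightarrow> 0"
    by (rule Lim_null_comparison[OF bound])
  then have "(\<lambda>n. crossings_variance n (k n) / ?V n) \<longlonglongrightarrow> 1"
    by (simp add: LIM_zero_iff)
  then have "(\<lambda>n. inverse (sqrt (crossings_variance n (k n) / ?V n))) \<longlonglongrightarrow> inverse (sqrt 1)"
    by (intro tendsto_intros) auto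
  moreover have "inverse (sqrt (a / b)) = sqrt b / sqrt a" for a b
    by (simp add: real_sqrt_divide)
  ultimately show ?thesis by (simp only: real_sqrt_one inverse_1)
qed

theorem theorem1p6:
  fixes k :: "nat \<Rightarrow> nat"
  assumes "\<And>n. n \<ge> 1 \<Longrightarrow> 1 \<le> k n \<and> k n \<le> n"
    and "(\<lambda>n. real (k n)) \<in> o[sequentially](\<lambda>n. sqrt (real n))"
  shows "(\<lambda>n. crossings_variance n (k n) - ((real (k n))\<^sup>2 - 1) / 12 * real n)
           \<in> O[sequentially](\<lambda>n. (real (k n)) ^ 3 * sqrt (real n))
       \<and> ((\<forall>\<^sub>F n in sequentially. k n \<ge> 2) \<longrightarrow>
          weak_conv_m
            (\<lambda>n. distr (measure_pmf (partition_pmf n (k n))) borel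
                   (\<lambda>\<pi>. (crossings_rv \<pi> - crossings_mean n (k n))
                          / sqrt (crossings_variance n (k n))))
            std_normal_distribution)"
proof (intro conjI impI)
  have few: "\<forall>\<^sub>F n in sequentially. few_blocks n (k n)"
    using assms by (intro eventually_few_blocks) auto
  show "(\<lambda>n. crossings_variance n (k n) - ((real (k n))\<^sup>2 - 1) / 12 * real n)
           \<in> O[sequentially](\<lambda>n. (real (k n)) ^ 3 * sqrt (real n))"
  proof (rule bigoI[where c = 48])
    show "\<forall>\<^sub>F n in sequentially. norm (crossings_variance n (k n) - ((real (k n))\<^sup>2 - 1) / 12 * real n)
        \<le> 48 * norm ((real (k n)) ^ 3 * sqrt (real n))"
      using few by eventually_elim (use crossings_variance_near in simp)
  qed
  assume k: "\<forall>\<^sub>F n in sequentially. k n \<ge> 2"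
  have lim: "(\<lambda>n. real (k n) / sqrt (real n)) \<longlonglongrightarrow> 0"
    using assms(2) by (rule smalloD_tendsto)
  show "weak_conv_m
            (\<lambda>n. distr (measure_pmf (partition_pmf n (k n))) borel
                   (\<lambda>\<pi>. (crossings_rv \<pi> - crossings_mean n (k n))
                          / sqrt (crossings_variance n (k n))))
            std_normal_distribution" (is "weak_conv_m ?M _")
  proof (rule levy_continuity)
    show "real_distribution (?M n)" for n
      by (rule prob_space.real_distribution_distr[OF measure_pmf.prob_space_axioms]) simp
    show "real_distribution std_normal_distribution"
      by (rule real_dist_normal_dist)
    fix t :: real
    define \<tau> where "\<tau> n = t * (sqrt (real n * (((real (k n))\<^sup>2 - 1) / 12)) / sqrt (crossings_variance n (k n)))" for n
    have \<tau>: "\<tau> \<longlonglongrightarrow> t"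
      unfolding \<tau>_def using tendsto_mult_left[OF std_dev_ratio_tendsto[OF few k lim], of t] by simp
    have inv: "(\<lambda>n. 1 / sqrt (real n)) \<longlonglongrightarrow> 0" "(\<lambda>n. 1 / (8 * real n)) \<longlonglongrightarrow> 0"
      by real_asymp+
    have "(\<lambda>n. (32 * \<bar>\<tau> n\<bar> + 2) * (real (k n) / sqrt (real n)) + 11 * \<bar>\<tau> n\<bar> ^ 3 * (1 / sqrt (real n))
        + \<tau> n ^ 4 * (1 / (8 * real n))) \<longlonglongrightarrow> (32 * \<bar>t\<bar> + 2) * 0 + 11 * \<bar>t\<bar> ^ 3 * 0 + t ^ 4 * 0"
      by (intro tendsto_intros \<tau> lim inv)
    then have "(\<lambda>n. (32 * \<bar>\<tau> n\<bar> + 2) * (real (k n) / sqrt (real n)) + 11 * \<bar>\<tau> n\<bar> ^ 3 / sqrt (real n)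
        + \<tau> n ^ 4 / (8 * real n)) \<longlonglongrightarrow> 0"
      by simp
    moreover have "\<forall>\<^sub>F n in sequentially. norm (char (?M n) t - of_real (exp (- ((\<tau> n)\<^sup>2) / 2)))
        \<le> (32 * \<bar>\<tau> n\<bar> + 2) * (real (k n) / sqrt (real n)) + 11 * \<bar>\<tau> n\<bar> ^ 3 / sqrt (real n)
        + \<tau> n ^ 4 / (8 * real n)"
      using few k unfolding \<tau>_def by eventually_elim (rule crossings_char_approx)
    ultimately have "(\<lambda>n. char (?M n) t - of_real (exp (- ((\<tau> n)\<^sup>2) / 2))) \<longlonglongrightarrow> 0"
      by (rule Lim_null_comparison[rotated])
    moreover have "(\<lambda>n. complex_of_real (exp (- ((\<tau> n)\<^sup>2) / 2))) \<longlonglongrightarrow> of_real (exp (- (t\<^sup>2) / 2))"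
      by (intro tendsto_intros \<tau>) auto
    ultimately have "(\<lambda>n. char (?M n) t - of_real (exp (- ((\<tau> n)\<^sup>2) / 2)) + of_real (exp (- ((\<tau> n)\<^sup>2) / 2)))
        \<longlonglongrightarrow> 0 + of_real (exp (- (t\<^sup>2) / 2))"
      by (rule tendsto_add)
    then show "(\<lambda>n. char (?M n) t) \<longlonglongrightarrow> char std_normal_distribution t"
      by (simp add: char_std_normal_distribution)
  qed
qed

end
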